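(* Let $(D,\mu)$ be a measure space, let $V_m\subset L_2(D,\mu)$ be an $m$-dimensional space of functions ($m\ge 1$), and let $H\neq\{0\}$ be a reproducing kernel Hilbert space of functions on $D$ with kernel $K$, contained in $L_2(D,\mu)$, such that $$\lambda:=\sup_{f\in H\setminus\{0\}}\frac{\|f\|_2^2}{\|f\|_H^2}<\infty,\qquad \|f\|_2\neq 0\ \text{ for all } f\in H\setminus\{0\},\qquad \operatorname{Tr}(K):=\int_D K(x,x)\,d\mu(x)<\infty .$$ Put $M:=\operatorname{Tr}(K)/\lambda$. Then for every integer $n\ge m$ there exist points $x_1,\dots,x_n\in D$ and weights $w_1,\dots,w_n>0$ such that $$\Big(1-\sqrt{\tfrac{m-1}{n}}\Big)\|f\|_2\ \le\ \sqrt{\sum_{i=1}^n w_i|f(x_i)|^2}\qquad\text{for all } f\in V_m$$ and $$\sqrt{\sum_{i=1}^n w_i|g(x_i)|^2}\ \le\ \Big(1+\sqrt{\tfrac{M-1}{n}}\Big)\sqrt{\lambda}\,\|g\|_H\qquad\text{for all } g\in H.$$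
   Context: Functions are complex-valued, and $L_2(D,\mu)$ and its subspaces consist of functions, not equivalence classes. $\|\cdot\|_2$ is the norm of $L_2(D,\mu)$. A reproducing kernel Hilbert space on $D$ is a Hilbert space of functions on $D$ for which all point evaluations are continuous; its kernel $K$ is characterized by $K(x,\cdot)\in H$ and $\langle f,K(x,\cdot)\rangle_H=f(x)$. *)

theory Defs
  imports "HOL-Analysis.Analysis" "HOL-Library.Function_Algebras"
begin

text \<open>A complex function on a set \<open>D\<close> is represented by the function on the whole type that
  vanishes off \<open>D\<close>. Two functions on \<open>D\<close> are thus equal iff they agree at every point of \<open>D\<close>,
  and the pointwise operations of the function type are those of functions on \<open>D\<close>.\<close>

definition functions_on :: "'a set \<Rightarrow> ('a \<Rightarrow> complex) set" where
  "functions_on D = {f. \<forall>x. x \<notin> D \<longrightarrow> f x = 0}"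

definition scale_fun :: "complex \<Rightarrow> ('a \<Rightarrow> complex) \<Rightarrow> 'a \<Rightarrow> complex" where
  "scale_fun c f = (\<lambda>x. c * f x)"

global_interpretation cfun: vector_space "scale_fun :: complex \<Rightarrow> ('a \<Rightarrow> complex) \<Rightarrow> 'a \<Rightarrow> complex"
  by unfold_locales (auto simp: scale_fun_def fun_eq_iff algebra_simps)

definition L2_space :: "'a measure \<Rightarrow> ('a \<Rightarrow> complex) set" where
  "L2_space \<mu> = {f \<in> functions_on (space \<mu>).
     f \<in> borel_measurable \<mu> \<and> integrable \<mu> (\<lambda>x. (cmod (f x))\<^sup>2)}"

definition L2_norm :: "'a measure \<Rightarrow> ('a \<Rightarrow> complex) \<Rightarrow> real" where
  "L2_norm \<mu> f = sqrt (\<integral>x. (cmod (f x))\<^sup>2 \<partial>\<mu>)"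

definition ip_norm :: "(('a \<Rightarrow> complex) \<Rightarrow> ('a \<Rightarrow> complex) \<Rightarrow> complex) \<Rightarrow> ('a \<Rightarrow> complex) \<Rightarrow> real" where
  "ip_norm ip f = sqrt (Re (ip f f))"

text \<open>The inner product is linear in its first argument. Its values outside \<open>H\<close> are irrelevant.\<close>

locale hilbert_function_space =
  fixes D :: "'a set"
    and H :: "('a \<Rightarrow> complex) set"
    and ip :: "('a \<Rightarrow> complex) \<Rightarrow> ('a \<Rightarrow> complex) \<Rightarrow> complex"
  assumes functions_on_D: "H \<subseteq> functions_on D"
    and subspace: "cfun.subspace H"
    and ip_add: "\<lbrakk>f \<in> H; g \<in> H; h \<in> H\<rbrakk> \<Longrightarrow> ip (f + g) h = ip f h + ip g h"
    and ip_scale: "\<lbrakk>f \<in> H; g \<in> H\<rbrakk> \<Longrightarrow> ip (scale_fun c f) g = c * ip f g"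
    and ip_cnj: "\<lbrakk>f \<in> H; g \<in> H\<rbrakk> \<Longrightarrow> ip g f = cnj (ip f g)"
    and ip_pos: "\<lbrakk>f \<in> H; f \<noteq> 0\<rbrakk> \<Longrightarrow> 0 < Re (ip f f)"
    and complete: "\<lbrakk>\<And>k. X k \<in> H;
        \<And>e. 0 < e \<Longrightarrow> \<exists>N. \<forall>j\<ge>N. \<forall>k\<ge>N. ip_norm ip (X j - X k) < e\<rbrakk>
      \<Longrightarrow> \<exists>f\<in>H. (\<lambda>k. ip_norm ip (X k - f)) \<longlonglongrightarrow> 0"

locale rkhs = hilbert_function_space +
  assumes eval_continuous: "\<lbrakk>x \<in> D; f \<in> H; 0 < e\<rbrakk>
      \<Longrightarrow> \<exists>d>0. \<forall>g\<in>H. ip_norm ip (g - f) < d \<longrightarrow> cmod (g x - f x) < e"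

locale rkhs_with_kernel = rkhs +
  fixes K :: "'a \<Rightarrow> 'a \<Rightarrow> complex"
  assumes kernel_in: "x \<in> D \<Longrightarrow> K x \<in> H"
    and reproducing: "\<lbrakk>x \<in> D; f \<in> H\<rbrakk> \<Longrightarrow> ip f (K x) = f x"

text \<open>The diagonal of a reproducing kernel is real and nonnegative, since
  \<open>K x x = ip (K x) (K x)\<close>; hence taking real parts loses nothing.\<close>

definition kernel_trace :: "'a measure \<Rightarrow> ('a \<Rightarrow> 'a \<Rightarrow> complex) \<Rightarrow> real" where
  "kernel_trace \<mu> K = (\<integral>x. Re (K x x) \<partial>\<mu>)"

end

theory Submission
  imports Defs
begin

text \<open>The points are chosen one at a time by the barrier method of Batson, Spielman and
  Srivastava, with reproducing kernels in place of matrices.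

  Let \<open>q\<close> be a hermitian form on a Hilbert space \<open>H\<close> of functions, comparable to its inner product.
  Then \<open>H\<close> has a reproducing kernel with respect to \<open>q\<close>, that is \<open>q f k\<^sub>x = f x\<close>, and the potential
  of \<open>q\<close> is its trace \<open>\<integral> k\<^sub>x x d\<mu>\<close>. Since \<open>|f x|\<^sup>2 \<le> q f f * k\<^sub>x x\<close>, integration gives
  \<open>\<parallel>f\<parallel>\<^sub>2\<^sup>2 \<le> q f f * trace q\<close>. So if the trace is at most \<open>e\<close>, the form is not only positive, but
  at least \<open>\<parallel>f\<parallel>\<^sub>2\<^sup>2 / e\<close>. The upper bound follows the forms
  \<open>c * lam * \<parallel>f\<parallel>\<^sub>H\<^sup>2 - r * \<parallel>f\<parallel>\<^sub>2\<^sup>2 - (\<Sum>i. w\<^sub>i * |f x\<^sub>i|\<^sup>2)\<close> on \<open>H\<close>, the lower bound the forms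
  \<open>(\<Sum>i. w\<^sub>i * |f x\<^sub>i|\<^sup>2) - l * \<parallel>f\<parallel>\<^sub>2\<^sup>2\<close> on \<open>V\<close>. A step moves \<open>r\<close> down or \<open>l\<close> up by a constant \<open>d\<close> and
  adds a point; the traces must not increase, and positivity after \<open>n\<close> steps is the claim. The
  excess \<open>\<parallel>f\<parallel>\<^sub>2\<^sup>2 / e\<close> at the end turns \<open>m\<close> and \<open>M\<close> into \<open>m - 1\<close> and \<open>M - 1\<close>. Measuring the upper
  barrier by \<open>\<parallel>f\<parallel>\<^sub>2\<close> rather than \<open>\<parallel>f\<parallel>\<^sub>H\<close> makes the trace of the kernel play the role that the
  dimension plays on \<open>V\<close>.

  A step has two parts: the shift by \<open>d * \<parallel>f\<parallel>\<^sub>2\<^sup>2\<close>, whose effect on the kernel is estimated pointwise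
  in \<open>shift_form_kernel\<close>, and a point evaluation, for which the kernel changes by an explicit
  rank-one term (\<open>form_diagonal_add_evaluation\<close>). They show that \<open>x\<close> may be added with weight \<open>w\<close>
  whenever \<open>U x \<le> 1 / w\<close> for the upper form, and \<open>1 / w \<le> L x\<close> for the lower one, where
  \<open>\<integral> U d\<mu> \<le> 1 / d + e\<close> and \<open>\<integral> L d\<mu> \<ge> 1 / d' - e'\<close> (\<open>upper_barrier_step\<close>,
  \<open>lower_barrier_step\<close>). The parameters are chosen so that both numbers are \<open>1\<close>; hence \<open>U x \<le> L x\<close>
  for some \<open>x\<close>, and this point can be used for both bounds with the weight \<open>1 / L x\<close>
  (\<open>strategies_combine\<close>). If \<open>m = 1\<close> the optimal \<open>e\<close> is \<open>0\<close>, and if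
  \<open>n * (M - 1) < 1\<close> the optimal \<open>r\<close> is negative at the start. In these cases \<open>L\<close> or \<open>U\<close> is replaced
  by its limit for \<open>e \<rightarrow> 0\<close>, which is the diagonal of the kernel up to a factor.

  Two analytic points remain. The diagonal of the kernel of \<open>q\<close> has to be measurable: the finite
  trace and the injectivity of \<open>H \<rightarrow> L\<^sub>2\<close> make every orthonormal set countable, so the diagonal is a
  countable sum of products of functions in \<open>H\<close> and conjugates of such functions
  (\<open>form_kernel_measurable\<close>). And \<open>V\<close> may contain
  functions that vanish almost everywhere without being zero: \<open>V\<close> agrees, off a null set which the
  points avoid, with the span of at most \<open>m\<close> functions that are orthonormal in \<open>L\<^sub>2\<close>
  (\<open>orthonormal_expansion_off_null_set\<close>).\<close>

section \<open>Hermitian forms on spaces of functions\<close>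

lemma quadratic_nonneg_imp_discriminant:
  fixes a b c :: real
  assumes "0 \<le> a" and nonneg: "\<And>s. 0 \<le> a * s\<^sup>2 + 2 * b * s + c"
  shows "b\<^sup>2 \<le> a * c"
proof (cases "a = 0")
  case True
  have "b = 0"
  proof (rule ccontr)
    assume "b \<noteq> 0"
    then show False
      using nonneg[of "- (c + 1) / (2 * b)"] True by (simp add: field_simps)
  qed
  then show ?thesis using True by simp
next
  case False
  then have "a > 0" using assms(1) by simp
  then show ?thesis
    using nonneg[of "- b / a"] by (simp add: field_simps power2_eq_square)
qed

lemma tendsto_zero_of_square_le:
  fixes a b :: "nat \<Rightarrow> real"
  assumes le: "\<And>k. (a k)\<^sup>2 \<le> b k" and lim: "b \<longlonglongrightarrow> 0"
  shows "a \<longlonglongrightarrow> 0"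
proof (rule Lim_null_comparison)
  show "\<forall>\<^sub>F k in sequentially. norm (a k) \<le> sqrt (b k)"
    using le real_le_rsqrt[of "\<bar>a _\<bar>"] by (intro always_eventually) simp
  show "(\<lambda>k. sqrt (b k)) \<longlonglongrightarrow> 0"
    using tendsto_real_sqrt[OF lim] by simp
qed

locale hermitian_form =
  fixes H :: "('a \<Rightarrow> complex) set"
    and r :: "('a \<Rightarrow> complex) \<Rightarrow> ('a \<Rightarrow> complex) \<Rightarrow> complex"
  assumes subspace: "cfun.subspace H"
    and add_left: "\<lbrakk>f \<in> H; g \<in> H; h \<in> H\<rbrakk> \<Longrightarrow> r (f + g) h = r f h + r g h"
    and scale_left: "\<lbrakk>f \<in> H; g \<in> H\<rbrakk> \<Longrightarrow> r (scale_fun c f) g = c * r f g"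
    and herm: "\<lbrakk>f \<in> H; g \<in> H\<rbrakk> \<Longrightarrow> r g f = cnj (r f g)"
begin

lemma mem [simp]:
  shows "f \<in> H \<Longrightarrow> g \<in> H \<Longrightarrow> f + g \<in> H" and "f \<in> H \<Longrightarrow> g \<in> H \<Longrightarrow> f - g \<in> H"
    and "f \<in> H \<Longrightarrow> scale_fun c f \<in> H" and "0 \<in> H"
  using subspace cfun.subspace_add cfun.subspace_diff cfun.subspace_scale cfun.subspace_0
  by blast+

lemma diff_left: "\<lbrakk>f \<in> H; g \<in> H; h \<in> H\<rbrakk> \<Longrightarrow> r (f - g) h = r f h - r g h"
  using add_left[of "f - g" g h] by simp

lemma add_right: "\<lbrakk>f \<in> H; g \<in> H; h \<in> H\<rbrakk> \<Longrightarrow> r h (f + g) = r h f + r h g"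
  using add_left[of f g h] herm[of f h] herm[of g h] herm[of "f + g" h] by simp

lemma diff_right: "\<lbrakk>f \<in> H; g \<in> H; h \<in> H\<rbrakk> \<Longrightarrow> r h (f - g) = r h f - r h g"
  using diff_left[of f g h] herm[of f h] herm[of g h] herm[of "f - g" h] by simp

lemma scale_right: "\<lbrakk>f \<in> H; g \<in> H\<rbrakk> \<Longrightarrow> r g (scale_fun c f) = cnj c * r g f"
  using scale_left[of f g c] herm[of f g] herm[of "scale_fun c f" g] by simp

lemma zero_left: "g \<in> H \<Longrightarrow> r 0 g = 0"
  using diff_left[of 0 0 g] by simp

lemma zero_right: "g \<in> H \<Longrightarrow> r g 0 = 0"
  using diff_right[of 0 0 g] by simp

lemma sum_left: "\<lbrakk>finite I; \<And>i. i \<in> I \<Longrightarrow> f i \<in> H; h \<in> H\<rbrakk> \<Longrightarrow> r (sum f I) h = (\<Sum>i\<in>I. r (f i) h)"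
proof (induction I rule: finite_induct)
  case empty
  then show ?case by (simp only: sum.empty zero_left)
next
  case (insert i I)
  then have "sum f I \<in> H"
    using cfun.subspace_sum[OF subspace, of I f] by blast
  then show ?case
    using insert by (simp only: sum.insert add_left insert_iff simp_thms)
qed

lemma diagonal_real: "f \<in> H \<Longrightarrow> r f f = of_real (Re (r f f))"
  using herm[of f f] by (metis Reals_cnj_iff of_real_Re)

lemma diagonal_add:
  "\<lbrakk>f \<in> H; g \<in> H\<rbrakk> \<Longrightarrow> Re (r (f + g) (f + g)) = Re (r f f) + 2 * Re (r f g) + Re (r g g)"
  using herm[of f g] by (simp add: add_left add_right)

lemma diagonal_diff:
  "\<lbrakk>f \<in> H; g \<in> H\<rbrakk> \<Longrightarrow> Re (r (f - g) (f - g)) = Re (r f f) - 2 * Re (r f g) + Re (r g g)"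
  using herm[of f g] by (simp add: diff_left diff_right)

lemma diagonal_scale: "f \<in> H \<Longrightarrow> Re (r (scale_fun c f) (scale_fun c f)) = (cmod c)\<^sup>2 * Re (r f f)"
proof -
  assume f: "f \<in> H"
  have "r (scale_fun c f) (scale_fun c f) = (c * cnj c) * r f f"
    using f by (simp add: scale_left scale_right)
  also have "\<dots> = of_real ((cmod c)\<^sup>2) * r f f" by (simp only: complex_norm_square)
  finally show ?thesis by simp
qed

lemma Cauchy_Schwarz:
  assumes pos: "\<And>h. h \<in> H \<Longrightarrow> 0 \<le> Re (r h h)" and f: "f \<in> H" and g: "g \<in> H"
  shows "(cmod (r f g))\<^sup>2 \<le> Re (r f f) * Re (r g g)"
proof -
  have real_part: "(Re (r h g))\<^sup>2 \<le> Re (r g g) * Re (r h h)" if h: "h \<in> H" for h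
  proof (rule quadratic_nonneg_imp_discriminant)
    show "0 \<le> Re (r g g)" using pos g .
    fix s :: real
    have "0 \<le> Re (r (h + scale_fun (of_real s) g) (h + scale_fun (of_real s) g))"
      using pos h g by simp
    also have "\<dots> = Re (r h h) + 2 * s * Re (r h g) + s\<^sup>2 * Re (r g g)"
      using h g by (simp add: diagonal_add scale_left scale_right power2_eq_square)
    finally show "0 \<le> Re (r g g) * s\<^sup>2 + 2 * Re (r h g) * s + Re (r h h)"
      by (simp add: algebra_simps)
  qed
  show ?thesis
  proof (cases "r f g = 0")
    case True
    then show ?thesis using pos f g by simp
  next
    case False
    define u where "u = cnj (r f g) / of_real (cmod (r f g))"
    have "cmod u = 1" using False by (simp add: u_def norm_divide)
    have "u * r f g = of_real (cmod (r f g))"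
      using False complex_norm_square[of "r f g"]
      by (simp add: u_def field_simps power2_eq_square)
    then have "Re (r (scale_fun u f) g) = cmod (r f g)"
      using f g by (simp add: scale_left)
    then show ?thesis
      using real_part[of "scale_fun u f"] f diagonal_scale[OF f, of u] \<open>cmod u = 1\<close>
      by (simp add: mult.commute)
  qed
qed

end

lemma hermitian_form_add_scaled:
  assumes "hermitian_form H q" and "hermitian_form H r"
  shows "hermitian_form H (\<lambda>f g. q f g + of_real a * r f g)"
proof -
  interpret q: hermitian_form H q by fact
  interpret r: hermitian_form H r by fact
  show ?thesis
  proof
    show "cfun.subspace H" by (rule q.subspace)
  qed (simp_all add: q.add_left r.add_left q.scale_left r.scale_left algebra_simps,
      metis q.herm r.herm complex_cnj_complex_of_real complex_cnj_mult complex_cnj_add)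
qed

lemma hermitian_form_evaluation:
  assumes "cfun.subspace H"
  shows "hermitian_form H (\<lambda>f g. f x * cnj (g x))"
  by standard (auto simp: assms scale_fun_def algebra_simps)

section \<open>Forms comparable to the inner product, and Riesz representation\<close>

sublocale hilbert_function_space \<subseteq> ip: hermitian_form H ip
  by (rule hermitian_form.intro) (fact subspace ip_add ip_scale ip_cnj)+

context hilbert_function_space
begin

lemma ip_nonneg: "f \<in> H \<Longrightarrow> 0 \<le> Re (ip f f)"
  using ip_pos[of f] ip.zero_left[of f] by (cases "f = 0") auto

lemma ip_norm_square: "f \<in> H \<Longrightarrow> (ip_norm ip f)\<^sup>2 = Re (ip f f)"
  by (simp add: ip_norm_def ip_nonneg)

lemma ip_norm_nonneg [simp]: "0 \<le> ip_norm ip f" if "f \<in> H"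
  using ip_nonneg that by (simp add: ip_norm_def)

definition bounded_form where
  "bounded_form r \<longleftrightarrow> hermitian_form H r \<and> (\<exists>C. \<forall>f\<in>H. \<bar>Re (r f f)\<bar> \<le> C * Re (ip f f))"

definition coercive_form where
  "coercive_form q \<longleftrightarrow> bounded_form q \<and> (\<exists>\<beta>>0. \<forall>f\<in>H. \<beta> * Re (ip f f) \<le> Re (q f f))"

lemma bounded_form_ip: "bounded_form ip"
  unfolding bounded_form_def using ip.hermitian_form_axioms ip_nonneg by (auto intro!: exI[of _ 1])

lemma bounded_form_add_scaled:
  assumes "bounded_form q" and "bounded_form r"
  shows "bounded_form (\<lambda>f g. q f g + of_real a * r f g)"
proof -
  obtain C1 C2 where C: "\<forall>f\<in>H. \<bar>Re (q f f)\<bar> \<le> C1 * Re (ip f f)" "\<forall>f\<in>H. \<bar>Re (r f f)\<bar> \<le> C2 * Re (ip f f)"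
    using assms unfolding bounded_form_def by blast
  have "\<bar>Re (q f f + of_real a * r f f)\<bar> \<le> (C1 + \<bar>a\<bar> * C2) * Re (ip f f)" if "f \<in> H" for f
  proof -
    have "\<bar>Re (q f f + of_real a * r f f)\<bar> \<le> \<bar>Re (q f f)\<bar> + \<bar>a\<bar> * \<bar>Re (r f f)\<bar>"
      by (simp add: abs_mult[symmetric])
    also have "\<dots> \<le> C1 * Re (ip f f) + \<bar>a\<bar> * (C2 * Re (ip f f))"
      using C that by (intro add_mono mult_left_mono) auto
    finally show ?thesis by (simp add: algebra_simps)
  qed
  then show ?thesis
    using assms hermitian_form_add_scaled unfolding bounded_form_def by blast
qed

lemma coercive_form_hermitian: "coercive_form q \<Longrightarrow> hermitian_form H q"
  by (simp add: coercive_form_def bounded_form_def)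

lemma coercive_form_pos: "coercive_form q \<Longrightarrow> f \<in> H \<Longrightarrow> f \<noteq> 0 \<Longrightarrow> 0 < Re (q f f)"
  unfolding coercive_form_def by (meson ip_pos less_le_trans mult_pos_pos)

lemma coercive_form_nonneg: "coercive_form q \<Longrightarrow> f \<in> H \<Longrightarrow> 0 \<le> Re (q f f)"
  unfolding coercive_form_def by (meson ip_nonneg order_trans mult_nonneg_nonneg less_imp_le)

lemma coercive_form_minorant:
  assumes "coercive_form q" and "bounded_form q'" and "0 < t"
    and "\<And>f. f \<in> H \<Longrightarrow> t * Re (q f f) \<le> Re (q' f f)"
  shows "coercive_form q'"
proof -
  obtain \<beta> where "\<beta> > 0" and \<beta>: "\<And>f. f \<in> H \<Longrightarrow> \<beta> * Re (ip f f) \<le> Re (q f f)"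
    using assms(1) unfolding coercive_form_def by blast
  have "(t * \<beta>) * Re (ip f f) \<le> Re (q' f f)" if "f \<in> H" for f
    using mult_left_mono[OF \<beta>[OF that], of t] assms(3) assms(4)[OF that]
    unfolding mult.assoc by linarith
  then show ?thesis
    using assms(2,3) \<open>\<beta> > 0\<close> unfolding coercive_form_def by (meson mult_pos_pos)
qed

lemma coercive_form_ip: "coercive_form ip"
  unfolding coercive_form_def using bounded_form_ip by (auto intro!: exI[of _ 1])

text \<open>A coercive form makes \<open>H\<close> complete as well, so functionals that are bounded for the inner product
  are represented by \<open>q\<close>. The representing function is the limit of a minimizing sequence of
  \<open>q f f - 2 * Re (l f)\<close>; the parallelogram law makes such a sequence Cauchy.\<close>

lemma Riesz_representation:
  fixes l :: "('a \<Rightarrow> complex) \<Rightarrow> complex"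
  assumes q: "coercive_form q"
    and l_add: "\<And>f g. f \<in> H \<Longrightarrow> g \<in> H \<Longrightarrow> l (f + g) = l f + l g"
    and l_scale: "\<And>c f. f \<in> H \<Longrightarrow> l (scale_fun c f) = c * l f"
    and l_bound: "\<And>f. f \<in> H \<Longrightarrow> cmod (l f) \<le> C * ip_norm ip f"
  obtains g where "g \<in> H" and "\<And>f. f \<in> H \<Longrightarrow> q f g = l f"
proof -
  interpret q: hermitian_form H q using q by (rule coercive_form_hermitian)
  obtain \<beta> where \<beta>: "\<beta> > 0" "\<And>f. f \<in> H \<Longrightarrow> \<beta> * Re (ip f f) \<le> Re (q f f)"
    using q unfolding coercive_form_def by blast
  obtain B where B: "\<And>f. f \<in> H \<Longrightarrow> \<bar>Re (q f f)\<bar> \<le> B * Re (ip f f)"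
    using q unfolding coercive_form_def bounded_form_def by blast
  define J where "J f = Re (q f f) - 2 * Re (l f)" for f
  have J_lower: "- (C\<^sup>2 / \<beta>) \<le> J f" if "f \<in> H" for f
  proof -
    let ?N = "ip_norm ip f"
    have "2 * Re (l f) \<le> 2 * (C * ?N)"
      using l_bound[OF that] complex_Re_le_cmod[of "l f"] by linarith
    moreover have "0 \<le> (\<beta> * ?N - C)\<^sup>2 / \<beta>" using \<beta> by simp
    then have "0 \<le> \<beta> * ?N\<^sup>2 - 2 * (C * ?N) + C\<^sup>2 / \<beta>"
      using \<beta>(1) by (simp add: power2_diff field_simps power2_eq_square)
    ultimately show ?thesis
      using \<beta>(2)[OF that] unfolding J_def ip_norm_square[OF that] by linarith
  qed
  define I where "I = Inf (J ` H)"
  have bdd: "bdd_below (J ` H)" using J_lower by (intro bdd_belowI2) auto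
  have I_le: "I \<le> J f" if "f \<in> H" for f
    unfolding I_def using bdd that by (intro cInf_lower) auto
  have "\<exists>f\<in>H. J f < I + 1 / real (Suc k)" for k
  proof -
    have "J ` H \<noteq> {}" using q.mem(4) by blast
    then show ?thesis using cInf_lessD[of "J ` H" "I + 1 / real (Suc k)"] by (auto simp: I_def)
  qed
  then obtain X where X: "\<And>k. X k \<in> H" "\<And>k. J (X k) < I + 1 / real (Suc k)" by metis
  have half_sum: "\<beta> * (ip_norm ip (f - g))\<^sup>2 \<le> 2 * (J f - I) + 2 * (J g - I)"
    if f: "f \<in> H" and g: "g \<in> H" for f g
  proof -
    let ?h = "scale_fun (1/2) (f + g)"
    have "Re (l ?h) = (Re (l f) + Re (l g)) / 2" using f g l_scale l_add by simp
    moreover have "Re (q ?h ?h) = (1/4) * Re (q (f + g) (f + g))"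
      using q.diagonal_scale[of "f + g" "1/2"] f g by (simp add: power2_eq_square)
    ultimately have "4 * J ?h = Re (q (f + g) (f + g)) - 4 * (Re (l f) + Re (l g))"
      by (simp add: J_def)
    then have "Re (q (f - g) (f - g)) = 2 * J f + 2 * J g - 4 * J ?h"
      using f g by (simp add: J_def q.diagonal_add q.diagonal_diff)
    also have "\<dots> \<le> 2 * J f + 2 * J g - 4 * I" using I_le[of ?h] f g by simp
    finally show ?thesis using \<beta>(2)[of "f - g"] f g by (simp add: ip_norm_square)
  qed
  have "\<exists>g\<in>H. (\<lambda>k. ip_norm ip (X k - g)) \<longlonglongrightarrow> 0"
  proof (rule complete)
    show "X k \<in> H" for k by fact
    fix e :: real assume e: "0 < e"
    obtain N where "4 / (\<beta> * e\<^sup>2) < real N" using reals_Archimedean2 by blast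
    then have N: "4 / (\<beta> * e\<^sup>2) < real (Suc N)" by simp
    have "ip_norm ip (X j - X k) < e" if "N \<le> j" "N \<le> k" for j k
    proof -
      have "1 / real (Suc j) \<le> 1 / real (Suc N)" "1 / real (Suc k) \<le> 1 / real (Suc N)"
        using that by (auto simp: field_simps)
      then have "J (X j) - I \<le> 1 / real (Suc N)" "J (X k) - I \<le> 1 / real (Suc N)"
        using X(2)[of j] X(2)[of k] by linarith+
      then have "\<beta> * (ip_norm ip (X j - X k))\<^sup>2 \<le> 4 * (1 / real (Suc N))"
        using half_sum[OF X(1) X(1), of j k] by (simp only: mult_2)
      also have "\<dots> < \<beta> * e\<^sup>2" using N \<beta>(1) e by (simp add: field_simps)
      finally show ?thesis using \<beta>(1) e by (simp add: power_less_imp_less_base)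
    qed
    then show "\<exists>N. \<forall>j\<ge>N. \<forall>k\<ge>N. ip_norm ip (X j - X k) < e" by blast
  qed
  then obtain g where g: "g \<in> H" and lim: "(\<lambda>k. ip_norm ip (X k - g)) \<longlonglongrightarrow> 0" by blast
  have Re_eq: "Re (q g h) = Re (l h)" if h: "h \<in> H" for h
  proof -
    \<comment> \<open>Along every line through \<open>X k\<close> the functional drops by at most \<open>1 / Suc k\<close>, so its derivative at
      \<open>X k\<close> is small.\<close>
    have near_stationary: "(Re (q (X k) h - l h))\<^sup>2 \<le> Re (q h h) * (1 / real (Suc k))" for k
    proof (rule quadratic_nonneg_imp_discriminant)
      show "0 \<le> Re (q h h)" using coercive_form_nonneg q h .
      fix s :: real
      have "I \<le> J (X k + scale_fun (of_real s) h)" using I_le X(1) h by simp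
      also have "\<dots> = J (X k) + 2 * s * Re (q (X k) h - l h) + s\<^sup>2 * Re (q h h)"
        using X(1)[of k] h unfolding J_def
        by (simp add: q.diagonal_add q.scale_left q.scale_right l_add l_scale
            power2_eq_square algebra_simps)
      finally show "0 \<le> Re (q h h) * s\<^sup>2 + 2 * Re (q (X k) h - l h) * s + 1 / real (Suc k)"
        using X(2)[of k] by (simp add: algebra_simps)
    qed
    have "(\<lambda>k. Re (q h h) * (1 / real (Suc k))) \<longlonglongrightarrow> Re (q h h) * 0"
      by (intro tendsto_mult tendsto_const LIMSEQ_Suc lim_1_over_n)
    then have "(\<lambda>k. Re (q (X k) h - l h)) \<longlonglongrightarrow> 0"
      using tendsto_zero_of_square_le[OF near_stationary] by simp
    then have 1: "(\<lambda>k. Re (q (X k) h) - Re (l h)) \<longlonglongrightarrow> 0" by simp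
    have "(\<lambda>k. B * (ip_norm ip (X k - g))\<^sup>2 * Re (q h h)) \<longlonglongrightarrow> B * 0\<^sup>2 * Re (q h h)"
      by (intro tendsto_intros lim)
    moreover have "(Re (q (X k) h - q g h))\<^sup>2 \<le> B * (ip_norm ip (X k - g))\<^sup>2 * Re (q h h)" for k
    proof -
      have "(Re (q (X k) h - q g h))\<^sup>2 \<le> (cmod (q (X k - g) h))\<^sup>2"
        using X(1) g h abs_Re_le_cmod by (metis abs_le_square_iff abs_norm_cancel q.diff_left)
      also have "\<dots> \<le> Re (q (X k - g) (X k - g)) * Re (q h h)"
        using q.Cauchy_Schwarz[of "X k - g" h] coercive_form_nonneg[OF q] X(1) g h by simp
      also have "\<dots> \<le> B * (ip_norm ip (X k - g))\<^sup>2 * Re (q h h)"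
        using B[of "X k - g"] X(1) g h coercive_form_nonneg[OF q h]
        by (intro mult_right_mono) (auto simp: ip_norm_square)
      finally show ?thesis .
    qed
    ultimately have "(\<lambda>k. Re (q (X k) h - q g h)) \<longlonglongrightarrow> 0"
      using tendsto_zero_of_square_le[of "\<lambda>k. Re (q (X k) h - q g h)"
          "\<lambda>k. B * (ip_norm ip (X k - g))\<^sup>2 * Re (q h h)"] by simp
    then have 2: "(\<lambda>k. Re (q (X k) h) - Re (q g h)) \<longlonglongrightarrow> 0" by simp
    show ?thesis using tendsto_diff[OF 1 2] by (simp add: LIMSEQ_const_iff)
  qed
  have "q h g = l h" if h: "h \<in> H" for h
  proof (rule complex_eqI)
    show "Re (q h g) = Re (l h)" using Re_eq[OF h] q.herm[OF g h] by simp
    have "Re (q g (scale_fun \<i> h)) = Re (l (scale_fun \<i> h))" using Re_eq h by simp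
    then show "Im (q h g) = Im (l h)"
      using h g l_scale q.herm[OF g h] by (simp add: q.scale_right)
  qed
  with g that show thesis by blast
qed

end

context hermitian_form
begin

text \<open>Zero vectors are admitted, so that a finite or countable orthonormal set can be listed as a
  sequence.\<close>

definition orthonormal where
  "orthonormal I b \<longleftrightarrow> (\<forall>i\<in>I. b i \<in> H \<and> (b i = 0 \<or> r (b i) (b i) = 1)) \<and>
     (\<forall>i\<in>I. \<forall>j\<in>I. i \<noteq> j \<longrightarrow> r (b i) (b j) = 0)"

definition projection where
  "projection I b f = (\<Sum>i\<in>I. scale_fun (r f (b i)) (b i))"

lemma projection_mem:
  assumes "orthonormal A b" and "I \<subseteq> A"
  shows "projection I b f \<in> H"
  unfolding projection_def using assms
  by (intro cfun.subspace_sum[OF subspace]) (auto simp: orthonormal_def)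

lemma projection_left:
  assumes "orthonormal A b" and "finite I" and "I \<subseteq> A" and "g \<in> H"
  shows "r (projection I b f) g = (\<Sum>i\<in>I. r f (b i) * r (b i) g)"
proof -
  have b: "b i \<in> H" if "i \<in> I" for i using assms(1,3) that by (auto simp: orthonormal_def)
  have "r (projection I b f) g = (\<Sum>i\<in>I. r (scale_fun (r f (b i)) (b i)) g)"
    unfolding projection_def using assms(2,4) b by (intro sum_left) auto
  also have "\<dots> = (\<Sum>i\<in>I. r f (b i) * r (b i) g)"
    using assms(4) b by (intro sum.cong) (auto simp: scale_left)
  finally show ?thesis .
qed

lemma projection_coefficient:
  assumes "orthonormal A b" and "finite I" and "I \<subseteq> A" and "j \<in> A" and "f \<in> H"
  shows "r (projection I b f) (b j) = (if j \<in> I then r f (b j) else 0)"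
proof -
  have b: "b i \<in> H" "b i = 0 \<or> r (b i) (b i) = 1" "i \<noteq> j \<Longrightarrow> r (b i) (b j) = 0"
    if "i \<in> A" for i using assms(1,4) that unfolding orthonormal_def by blast+
  have "r (projection I b f) (b j) = (\<Sum>i\<in>I. r f (b i) * r (b i) (b j))"
    using assms(1-3) b(1)[OF assms(4)] by (rule projection_left)
  also have "\<dots> = (\<Sum>i\<in>I. if i = j then r f (b j) else 0)"
    using b assms(3-5) zero_right[OF assms(5)] by (intro sum.cong refl) fastforce
  finally show ?thesis using assms(2) by simp
qed

lemma projection_inner_projection:
  assumes "orthonormal A b" and "finite I" and "I \<subseteq> A" and "finite J" and "J \<subseteq> A" and "f \<in> H"
  shows "r (projection I b f) (projection J b f) = of_real (\<Sum>i\<in>I \<inter> J. (cmod (r f (b i)))\<^sup>2)"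
proof -
  have P: "projection J b f \<in> H" using assms(1,5) by (rule projection_mem)
  have "r (b i) (projection J b f) = (if i \<in> J then cnj (r f (b i)) else 0)" if "i \<in> I" for i
    using projection_coefficient[OF assms(1,4,5) _ assms(6), of i] that assms(1,3)
      herm[OF P, of "b i"] by (auto simp: orthonormal_def)
  then have "r (projection I b f) (projection J b f)
      = (\<Sum>i\<in>I. if i \<in> J then of_real ((cmod (r f (b i)))\<^sup>2) else 0)"
    unfolding projection_left[OF assms(1-3) P]
    by (intro sum.cong refl) (simp only: complex_norm_square if_distrib mult_zero_right split: if_split, simp)
  also have "\<dots> = of_real (\<Sum>i\<in>I \<inter> J. (cmod (r f (b i)))\<^sup>2)"
    using sum.inter_restrict[OF assms(2), of "\<lambda>i. complex_of_real ((cmod (r f (b i)))\<^sup>2)" J]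
    by simp
  finally show ?thesis .
qed

lemma inner_projection_self:
  assumes "orthonormal A b" and "finite I" and "I \<subseteq> A" and "f \<in> H"
  shows "Re (r f (projection I b f)) = (\<Sum>i\<in>I. (cmod (r f (b i)))\<^sup>2)"
proof -
  have P: "projection I b f \<in> H" using assms(1,3) by (rule projection_mem)
  have "r (b i) f = cnj (r f (b i))" if "i \<in> I" for i
    using that assms(1,3,4) herm[of f "b i"] by (auto simp: orthonormal_def)
  then have "r (projection I b f) f = (\<Sum>i\<in>I. of_real ((cmod (r f (b i)))\<^sup>2))"
    unfolding projection_left[OF assms(1-4)] complex_norm_square by (intro sum.cong) auto
  then have "Re (r (projection I b f) f) = (\<Sum>i\<in>I. (cmod (r f (b i)))\<^sup>2)"
    by (simp only: of_real_sum[symmetric] Re_complex_of_real)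
  then show ?thesis using herm[OF assms(4) P] by simp
qed

lemma norm_diff_projection:
  assumes "orthonormal A b" and "finite I" and "I \<subseteq> A" and "f \<in> H"
  shows "Re (r (f - projection I b f) (f - projection I b f))
    = Re (r f f) - (\<Sum>i\<in>I. (cmod (r f (b i)))\<^sup>2)"
  using projection_inner_projection[OF assms(1-3) assms(2-4)] inner_projection_self[OF assms]
    projection_mem[OF assms(1,3), of f] assms(4) by (simp add: diagonal_diff)

lemma Bessel_inequality:
  assumes "\<And>h. h \<in> H \<Longrightarrow> 0 \<le> Re (r h h)"
    and "orthonormal A b" and "finite I" and "I \<subseteq> A" and "f \<in> H"
  shows "(\<Sum>i\<in>I. (cmod (r f (b i)))\<^sup>2) \<le> Re (r f f)"
  using norm_diff_projection[OF assms(2-5)] assms(1)[of "f - projection I b f"] assms(5)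
    projection_mem[OF assms(2,4), of f] by simp

end

section \<open>The inner product of \<open>L\<^sub>2\<close>\<close>

definition l2_ip :: "'a measure \<Rightarrow> ('a \<Rightarrow> complex) \<Rightarrow> ('a \<Rightarrow> complex) \<Rightarrow> complex" where
  "l2_ip \<mu> f g = (\<integral>x. f x * cnj (g x) \<partial>\<mu>)"

lemma L2_spaceD:
  assumes "f \<in> L2_space \<mu>"
  shows "f \<in> borel_measurable \<mu>" and "integrable \<mu> (\<lambda>x. (cmod (f x))\<^sup>2)" and "x \<notin> space \<mu> \<Longrightarrow> f x = 0"
  using assms by (auto simp: L2_space_def functions_on_def)

lemma borel_measurable_cnj [measurable]:
  assumes "f \<in> borel_measurable M"
  shows "(\<lambda>x. cnj (f x)) \<in> borel_measurable M"
  using borel_measurable_continuous_on[OF continuous_on_cnj[OF continuous_on_id] assms] .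

lemma integrable_L2_product:
  assumes f: "f \<in> L2_space \<mu>" and g: "g \<in> L2_space \<mu>"
  shows "integrable \<mu> (\<lambda>x. f x * cnj (g x))"
proof (rule Bochner_Integration.integrable_bound)
  note [measurable] = L2_spaceD(1)[OF f] L2_spaceD(1)[OF g]
  show "integrable \<mu> (\<lambda>x. (cmod (f x))\<^sup>2 + (cmod (g x))\<^sup>2)"
    using L2_spaceD(2)[OF f] L2_spaceD(2)[OF g] by simp
  show "(\<lambda>x. f x * cnj (g x)) \<in> borel_measurable \<mu>" by measurable
  have "cmod (f x) * cmod (g x) \<le> (cmod (f x))\<^sup>2 + (cmod (g x))\<^sup>2" for x
    using sum_squares_bound[of "cmod (f x)" "cmod (g x)"]
      mult_nonneg_nonneg[OF norm_ge_zero norm_ge_zero, of "f x" "g x"] by linarith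
  then show "AE x in \<mu>. norm (f x * cnj (g x)) \<le> norm ((cmod (f x))\<^sup>2 + (cmod (g x))\<^sup>2)"
    by (simp add: norm_mult)
qed

lemma subspace_L2_space: "cfun.subspace (L2_space \<mu>)"
proof (rule cfun.subspaceI)
  show "0 \<in> L2_space \<mu>" by (auto simp: L2_space_def functions_on_def zero_fun_def)
next
  fix f g assume f: "f \<in> L2_space \<mu>" and g: "g \<in> L2_space \<mu>"
  note [measurable] = L2_spaceD(1)[OF f] L2_spaceD(1)[OF g]
  have "integrable \<mu> (\<lambda>x. (cmod (f x + g x))\<^sup>2)"
  proof (rule Bochner_Integration.integrable_bound)
    show "integrable \<mu> (\<lambda>x. 2 * (cmod (f x))\<^sup>2 + 2 * (cmod (g x))\<^sup>2)"
      using L2_spaceD(2)[OF f] L2_spaceD(2)[OF g] by simp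
    have "(cmod (f x + g x))\<^sup>2 \<le> 2 * (cmod (f x))\<^sup>2 + 2 * (cmod (g x))\<^sup>2" for x
    proof -
      have "(cmod (f x + g x))\<^sup>2 \<le> (cmod (f x) + cmod (g x))\<^sup>2"
        by (intro power_mono norm_triangle_ineq) auto
      also have "\<dots> \<le> 2 * (cmod (f x))\<^sup>2 + 2 * (cmod (g x))\<^sup>2"
        using sum_squares_bound[of "cmod (f x)" "cmod (g x)"] by (simp add: power2_sum)
      finally show ?thesis .
    qed
    then show "AE x in \<mu>. norm ((cmod (f x + g x))\<^sup>2) \<le> norm (2 * (cmod (f x))\<^sup>2 + 2 * (cmod (g x))\<^sup>2)"
      by simp
  qed measurable
  then show "f + g \<in> L2_space \<mu>"
    using L2_spaceD(3)[OF f] L2_spaceD(3)[OF g]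
    by (auto simp: L2_space_def functions_on_def plus_fun_def)
next
  fix c f assume f: "f \<in> L2_space \<mu>"
  note [measurable] = L2_spaceD(1)[OF f]
  show "scale_fun c f \<in> L2_space \<mu>"
    using L2_spaceD(2,3)[OF f]
    by (auto simp: L2_space_def functions_on_def scale_fun_def norm_mult power_mult_distrib)
qed

interpretation l2: hermitian_form "L2_space \<mu>" "l2_ip \<mu>" for \<mu>
proof
  show "cfun.subspace (L2_space \<mu>)" by (rule subspace_L2_space)
  fix f g h :: "'a \<Rightarrow> complex" and c
  assume f: "f \<in> L2_space \<mu>" and g: "g \<in> L2_space \<mu>"
  show "l2_ip \<mu> (scale_fun c f) g = c * l2_ip \<mu> f g"
    by (simp add: l2_ip_def scale_fun_def mult.assoc)
  show "l2_ip \<mu> g f = cnj (l2_ip \<mu> f g)"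
    unfolding l2_ip_def by (simp add: mult.commute flip: Bochner_Integration.integral_cnj)
  assume h: "h \<in> L2_space \<mu>"
  show "l2_ip \<mu> (f + g) h = l2_ip \<mu> f h + l2_ip \<mu> g h"
    unfolding l2_ip_def using integrable_L2_product[OF f h] integrable_L2_product[OF g h]
    by (simp add: plus_fun_def algebra_simps)
qed

lemma l2_ip_self: "l2_ip \<mu> f f = of_real ((L2_norm \<mu> f)\<^sup>2)"
proof -
  have "l2_ip \<mu> f f = (\<integral>x. of_real ((cmod (f x))\<^sup>2) \<partial>\<mu>)"
    unfolding l2_ip_def complex_norm_square ..
  then show ?thesis by (simp add: L2_norm_def del: of_real_power)
qed

lemma Re_l2_ip_self: "Re (l2_ip \<mu> f f) = (L2_norm \<mu> f)\<^sup>2"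
  by (simp add: l2_ip_self del: of_real_power)

lemma L2_norm_square: "(L2_norm \<mu> f)\<^sup>2 = (\<integral>x. (cmod (f x))\<^sup>2 \<partial>\<mu>)"
  by (simp add: L2_norm_def)

lemma L2_norm_nonneg [simp]: "0 \<le> L2_norm \<mu> f"
  by (simp add: L2_norm_def)

lemma hermitian_form_subset:
  assumes "hermitian_form A r" and sub: "H \<subseteq> A" and "cfun.subspace H"
  shows "hermitian_form H r"
proof -
  interpret hermitian_form A r by fact
  show ?thesis
    by (rule hermitian_form.intro; (rule assms(3) add_left scale_left herm)?) (use sub in blast)+
qed

section \<open>Reproducing kernels of forms, and their measurability\<close>

locale L2_rkhs = rkhs_with_kernel "space \<mu>" H ip K for \<mu> :: "'a measure" and H ip K +
  assumes in_L2: "H \<subseteq> L2_space \<mu>"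
    and L2_definite: "\<lbrakk>f \<in> H; f \<noteq> 0\<rbrakk> \<Longrightarrow> L2_norm \<mu> f \<noteq> 0"
    and trace_finite: "integrable \<mu> (\<lambda>x. Re (K x x))"
    and nontrivial: "H \<noteq> {0}"
begin

lemma kernel_diagonal: "x \<in> space \<mu> \<Longrightarrow> Re (ip (K x) (K x)) = Re (K x x)"
  using reproducing[of x "K x"] kernel_in by simp

lemma evaluation_bound:
  assumes x: "x \<in> space \<mu>" and f: "f \<in> H"
  shows "(cmod (f x))\<^sup>2 \<le> Re (ip f f) * Re (K x x)"
  using ip.Cauchy_Schwarz[OF ip_nonneg f kernel_in[OF x]] reproducing[OF x f] kernel_diagonal[OF x]
  by simp

lemma kernel_diagonal_nonneg: "x \<in> space \<mu> \<Longrightarrow> 0 \<le> Re (K x x)"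
  using kernel_diagonal ip_nonneg kernel_in by metis

lemma L2_norm_le_trace:
  assumes f: "f \<in> H"
  shows "(L2_norm \<mu> f)\<^sup>2 \<le> kernel_trace \<mu> K * Re (ip f f)"
proof -
  have "(\<integral>x. (cmod (f x))\<^sup>2 \<partial>\<mu>) \<le> (\<integral>x. Re (ip f f) * Re (K x x) \<partial>\<mu>)"
    using f in_L2 trace_finite evaluation_bound[OF _ f]
    by (intro integral_mono) (auto dest: L2_spaceD(2))
  then show ?thesis by (simp add: L2_norm_square kernel_trace_def mult.commute)
qed

lemma hermitian_form_l2: "hermitian_form H (l2_ip \<mu>)"
  using l2.hermitian_form_axioms in_L2 subspace by (rule hermitian_form_subset)

lemma bounded_form_l2: "bounded_form (l2_ip \<mu>)"
  unfolding bounded_form_def Re_l2_ip_self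
  using hermitian_form_l2 L2_norm_le_trace by (auto intro!: exI[of _ "kernel_trace \<mu> K"])

lemma bounded_form_evaluation:
  assumes x: "x \<in> space \<mu>"
  shows "bounded_form (\<lambda>f g. f x * cnj (g x))"
proof -
  have "Re (f x * cnj (f x)) = (cmod (f x))\<^sup>2" for f :: "'a \<Rightarrow> complex"
    by (metis complex_norm_square Re_complex_of_real)
  then show ?thesis
    unfolding bounded_form_def using evaluation_bound[OF x] hermitian_form_evaluation[OF subspace]
    by (auto intro!: exI[of _ "Re (K x x)"] simp: mult.commute simp del: complex_cnj_mult times_complex.sel)
qed

text \<open>The functional \<open>r \<cdot> g\<close> is bounded by the Cauchy-Schwarz inequality for \<open>r\<close>.\<close>

lemma Riesz_form:
  assumes q: "coercive_form q" and r: "bounded_form r" and pos: "\<And>f. f \<in> H \<Longrightarrow> 0 \<le> Re (r f f)"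
    and g: "g \<in> H"
  obtains h where "h \<in> H" and "\<And>f. f \<in> H \<Longrightarrow> q f h = r f g"
proof -
  interpret r: hermitian_form H r using r by (simp add: bounded_form_def)
  obtain C where C: "\<And>f. f \<in> H \<Longrightarrow> \<bar>Re (r f f)\<bar> \<le> C * Re (ip f f)"
    using r unfolding bounded_form_def by blast
  have "cmod (r f g) \<le> sqrt (C * Re (r g g)) * ip_norm ip f" if f: "f \<in> H" for f
  proof -
    have "(cmod (r f g))\<^sup>2 \<le> Re (r f f) * Re (r g g)" using r.Cauchy_Schwarz[OF pos f g] .
    also have "\<dots> \<le> (C * Re (ip f f)) * Re (r g g)"
      using C[OF f] pos[OF g] by (intro mult_right_mono) auto
    finally have "cmod (r f g) \<le> sqrt ((C * Re (ip f f)) * Re (r g g))" by (rule real_le_rsqrt)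
    then show ?thesis by (simp add: ip_norm_def real_sqrt_mult algebra_simps)
  qed
  then show thesis
    using Riesz_representation[OF q, of "\<lambda>f. r f g"] r.add_left r.scale_left g that by blast
qed

text \<open>The function \<open>form_kernel q x\<close> is the reproducing kernel of \<open>H\<close> at \<open>x\<close> when \<open>H\<close> carries the inner
  product \<open>q\<close>.\<close>

definition form_kernel where
  "form_kernel q x = (SOME k. k \<in> H \<and> (\<forall>f\<in>H. q f k = f x))"

lemma form_kernel:
  assumes q: "coercive_form q" and x: "x \<in> space \<mu>"
  shows "form_kernel q x \<in> H" and "f \<in> H \<Longrightarrow> q f (form_kernel q x) = f x"
proof -
  obtain k where "k \<in> H" "\<And>f. f \<in> H \<Longrightarrow> q f k = ip f (K x)"
    using Riesz_form[OF q bounded_form_ip ip_nonneg kernel_in[OF x]] by blast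
  then have "\<exists>k. k \<in> H \<and> (\<forall>f\<in>H. q f k = f x)" using reproducing[OF x] by auto
  then have "form_kernel q x \<in> H \<and> (\<forall>f\<in>H. q f (form_kernel q x) = f x)"
    unfolding form_kernel_def by (rule someI_ex)
  then show "form_kernel q x \<in> H" and "f \<in> H \<Longrightarrow> q f (form_kernel q x) = f x" by auto
qed

lemma form_kernel_unique:
  assumes q: "coercive_form q" and x: "x \<in> space \<mu>" and k: "k \<in> H" "\<And>f. f \<in> H \<Longrightarrow> q f k = f x"
  shows "form_kernel q x = k"
proof (rule ccontr)
  interpret q: hermitian_form H q using q by (rule coercive_form_hermitian)
  let ?d = "form_kernel q x - k"
  assume "form_kernel q x \<noteq> k"
  then have "?d \<noteq> 0" by simp
  moreover have "q ?d ?d = 0"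
    using form_kernel[OF q x] k by (simp add: q.diff_right)
  ultimately show False using coercive_form_pos[OF q, of ?d] form_kernel(1)[OF q x] k(1) by simp
qed

text \<open>By Bessel's inequality \<open>(\<Sum>f\<in>F. |f x|\<^sup>2) \<le> K x x\<close> for a finite orthonormal set \<open>F\<close>. Hence the
  numbers \<open>\<parallel>f\<parallel>\<^sub>2\<^sup>2\<close> over a maximal orthonormal set are summable. None of them is zero, so the set is
  countable.\<close>

lemma exists_countable_complete_orthonormal:
  obtains e :: "nat \<Rightarrow> 'a \<Rightarrow> complex"
  where "ip.orthonormal UNIV e" and "\<And>f. f \<in> H \<Longrightarrow> (\<And>i. ip f (e i) = 0) \<Longrightarrow> f = 0"
proof -
  let ?A = "{E. 0 \<notin> E \<and> ip.orthonormal E id}"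
  have "\<exists>E\<in>?A. \<forall>X\<in>?A. E \<subseteq> X \<longrightarrow> X = E"
  proof (rule subset_Zorn')
    fix C assume C: "subset.chain ?A C"
    then have "\<exists>E\<in>C. f \<in> E \<and> g \<in> E" if "f \<in> \<Union>C" "g \<in> \<Union>C" for f g
      using that unfolding subset_chain_def by blast
    moreover have CA: "0 \<notin> E \<and> ip.orthonormal E id" if "E \<in> C" for E
      using C that unfolding subset_chain_def by blast
    ultimately have "ip.orthonormal {f, g} id" if "f \<in> \<Union>C" "g \<in> \<Union>C" for f g
      using that unfolding ip.orthonormal_def by (metis insert_iff singletonD)
    then have "ip.orthonormal (\<Union>C) id"
      unfolding ip.orthonormal_def by (meson insertI1 insertI2)
    with CA show "\<Union>C \<in> ?A" by blast
  qed
  then obtain E where E: "0 \<notin> E" "ip.orthonormal E id"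
    and E_max: "\<And>X. 0 \<notin> X \<Longrightarrow> ip.orthonormal X id \<Longrightarrow> E \<subseteq> X \<Longrightarrow> X = E" by blast
  have E_H: "f \<in> H" "ip f f = 1" if "f \<in> E" for f
    using E that by (auto simp: ip.orthonormal_def)
  have E_sum: "(\<Sum>f\<in>F. (L2_norm \<mu> f)\<^sup>2) \<le> kernel_trace \<mu> K" if F: "F \<subseteq> E" "finite F" for F
  proof -
    have int: "integrable \<mu> (\<lambda>x. (cmod (f x))\<^sup>2)" if "f \<in> F" for f
      using that F E_H in_L2 L2_spaceD(2) by blast
    have "(\<Sum>f\<in>F. (L2_norm \<mu> f)\<^sup>2) = (\<integral>x. (\<Sum>f\<in>F. (cmod (f x))\<^sup>2) \<partial>\<mu>)"
      unfolding L2_norm_square using int by (intro Bochner_Integration.integral_sum[symmetric])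
    also have "\<dots> \<le> (\<integral>x. Re (K x x) \<partial>\<mu>)"
    proof (rule integral_mono)
      fix x assume x: "x \<in> space \<mu>"
      have "cmod (ip (K x) f) = cmod (f x)" if "f \<in> F" for f
        using that F E_H(1) ip_cnj[OF _ kernel_in[OF x], of f] reproducing[OF x, of f] by auto
      then show "(\<Sum>f\<in>F. (cmod (f x))\<^sup>2) \<le> Re (K x x)"
        using ip.Bessel_inequality[OF ip_nonneg E(2) F(2,1) kernel_in[OF x]] kernel_diagonal[OF x]
        by simp
    qed (use int trace_finite in auto)
    finally show ?thesis by (simp add: kernel_trace_def)
  qed
  have "(\<lambda>f. (L2_norm \<mu> f)\<^sup>2) summable_on E"
    using E_sum by (intro nonneg_bdd_above_summable_on bdd_aboveI2) auto
  then have "countable {f \<in> E. (L2_norm \<mu> f)\<^sup>2 \<noteq> 0}" by (rule summable_countable_real)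
  moreover have "{f \<in> E. (L2_norm \<mu> f)\<^sup>2 \<noteq> 0} = E"
    using E(1) E_H(1) L2_definite by auto
  ultimately have E_count: "countable E" by simp
  define e where "e i = (if i \<in> to_nat_on E ` E then from_nat_into E i else 0)" for i
  have e_cases: "e i \<in> E \<and> to_nat_on E (e i) = i \<or> e i = 0" for i
    using E_count by (auto simp: e_def)
  have "e i \<in> H" for i using e_cases[of i] E_H(1) ip.mem(4) by auto
  moreover have "e i = 0 \<or> ip (e i) (e i) = 1" for i using e_cases[of i] E_H(2) by auto
  moreover have "ip (e i) (e j) = 0" if "i \<noteq> j" for i j
  proof (cases "e i = 0 \<or> e j = 0")
    case True
    then show ?thesis using \<open>\<And>i. e i \<in> H\<close> ip.zero_left ip.zero_right by auto
  next
    case False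
    then have "e i \<in> E" "e j \<in> E" "e i \<noteq> e j" using e_cases that by metis+
    then show ?thesis using E(2) by (auto simp: ip.orthonormal_def)
  qed
  ultimately have e: "ip.orthonormal UNIV e" by (auto simp: ip.orthonormal_def)
  have "f = 0" if f: "f \<in> H" and orth: "\<And>i. ip f (e i) = 0" for f
  proof (rule ccontr)
    assume f0: "f \<noteq> 0"
    define c where "c = complex_of_real (1 / ip_norm ip f)"
    have pos: "0 < ip_norm ip f" using ip_pos[OF f f0] by (simp add: ip_norm_def)
    let ?u = "scale_fun c f"
    have u: "?u \<in> H" using f by simp
    have "Re (ip ?u ?u) = 1"
      using ip.diagonal_scale[OF f, of c] ip_pos[OF f f0] ip_norm_square[OF f]
      by (simp add: c_def norm_divide power_divide)
    then have u1: "ip ?u ?u = 1" using ip.diagonal_real[OF u] by simp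
    have u_orth: "ip ?u g = 0" if "g \<in> E" for g
    proof -
      have "e (to_nat_on E g) = g" using that E_count by (simp add: e_def)
      then have "ip f g = 0" using orth by metis
      then show ?thesis using f E_H(1)[OF that] by (simp add: ip.scale_left)
    qed
    then have u_orth': "ip g ?u = 0" if "g \<in> E" for g
      using that ip.herm[OF u E_H(1)[OF that]] by simp
    have "?u \<noteq> 0" using u1 ip.zero_left[OF ip.mem(4)] by auto
    then have "insert ?u E = E"
      using E u u1 u_orth u_orth' by (intro E_max) (auto simp: ip.orthonormal_def)
    then have "ip ?u ?u = 0" using u_orth by blast
    then show False using u1 by simp
  qed
  with e that show thesis by blast
qed

text \<open>The partial sums of the expansion of \<open>f\<close> are Cauchy by Bessel's inequality. Their limit has the
  same coefficients as \<open>f\<close>, hence equals \<open>f\<close>.\<close>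

lemma Parseval:
  assumes e: "ip.orthonormal (UNIV :: nat set) e"
    and complete_e: "\<And>f. f \<in> H \<Longrightarrow> (\<And>i. ip f (e i) = 0) \<Longrightarrow> f = 0"
    and f: "f \<in> H" and h: "h \<in> H"
  shows "(\<lambda>i. ip f (e i) * ip (e i) h) sums ip f h"
proof -
  define P where "P N = ip.projection {..<N} e f" for N
  define S where "S N = (\<Sum>i<N. (cmod (ip f (e i)))\<^sup>2)" for N
  have e_mem: "e i \<in> H" for i using e by (auto simp: ip.orthonormal_def)
  have P_mem: "P N \<in> H" for N unfolding P_def by (rule ip.projection_mem[OF e]) simp
  have Int_min: "{..<j} \<inter> {..<k} = {..<min j k}" for j k :: nat by auto
  have PP: "ip (P j) (P k) = of_real (S (min j k))" for j k
    unfolding P_def S_def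
    using ip.projection_inner_projection[OF e _ _ _ _ f, of "{..<j}" "{..<k}"]
      Int_min by simp
  have "summable (\<lambda>i. (cmod (ip f (e i)))\<^sup>2)"
    using ip.Bessel_inequality[OF ip_nonneg e _ _ f]
    by (intro summableI_nonneg_bounded[of _ "Re (ip f f)"]) auto
  then have "Cauchy S"
    unfolding S_def by (simp add: summable_iff_convergent Cauchy_convergent_iff)
  have "\<exists>g\<in>H. (\<lambda>k. ip_norm ip (P k - g)) \<longlonglongrightarrow> 0"
  proof (rule complete)
    fix d :: real assume "0 < d"
    then have "0 < d\<^sup>2" by simp
    then obtain N where N: "\<And>j k. j \<ge> N \<Longrightarrow> k \<ge> N \<Longrightarrow> \<bar>S j - S k\<bar> < d\<^sup>2"
      using metric_CauchyD[OF \<open>Cauchy S\<close>] unfolding dist_real_def by metis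
    have "ip_norm ip (P j - P k) < d" if "N \<le> j" "N \<le> k" for j k
    proof -
      have "Re (ip (P j - P k) (P j - P k)) = S j - 2 * S (min j k) + S k"
        using P_mem by (simp add: ip.diagonal_diff PP)
      also have "\<dots> \<le> \<bar>S j - S k\<bar>" by (cases "j \<le> k") (auto simp: min_def)
      finally have "(ip_norm ip (P j - P k))\<^sup>2 < d\<^sup>2"
        using N[OF that] P_mem by (simp add: ip_norm_square)
      then show ?thesis using \<open>0 < d\<close> by (simp add: power_less_imp_less_base)
    qed
    then show "\<exists>N. \<forall>j\<ge>N. \<forall>k\<ge>N. ip_norm ip (P j - P k) < d" by blast
  qed (rule P_mem)
  then obtain g where g: "g \<in> H" and lim: "(\<lambda>k. ip_norm ip (P k - g)) \<longlonglongrightarrow> 0" by blast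
  have weak: "(\<lambda>k. ip (P k) u) \<longlonglongrightarrow> ip g u" if u: "u \<in> H" for u
  proof (rule LIM_zero_cancel, rule Lim_null_comparison)
    have "cmod (ip (P k) u - ip g u) \<le> ip_norm ip (P k - g) * ip_norm ip u" for k
    proof -
      have "(cmod (ip (P k - g) u))\<^sup>2 \<le> (ip_norm ip (P k - g) * ip_norm ip u)\<^sup>2"
        using ip.Cauchy_Schwarz[OF ip_nonneg _ u, of "P k - g"] P_mem g u
        by (simp add: power_mult_distrib ip_norm_square)
      then have "cmod (ip (P k - g) u) \<le> ip_norm ip (P k - g) * ip_norm ip u"
        by (rule power2_le_imp_le) (use P_mem g u in simp)
      then show ?thesis unfolding ip.diff_left[OF P_mem g u] .
    qed
    then show "\<forall>\<^sub>F k in sequentially. norm (ip (P k) u - ip g u) \<le> ip_norm ip (P k - g) * ip_norm ip u"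
      by (intro always_eventually allI)
    show "(\<lambda>k. ip_norm ip (P k - g) * ip_norm ip u) \<longlonglongrightarrow> 0"
      using tendsto_mult_left_zero[OF lim] .
  qed
  have "ip g (e i) = ip f (e i)" for i
  proof (rule LIMSEQ_unique[OF weak[OF e_mem]], rule tendsto_eventually)
    have "ip (P k) (e i) = ip f (e i)" if "k > i" for k
      unfolding P_def using ip.projection_coefficient[OF e _ _ _ f, of "{..<k}" i] that by simp
    then show "\<forall>\<^sub>F k in sequentially. ip (P k) (e i) = ip f (e i)"
      using eventually_gt_at_top[of i] by (rule eventually_mono[rotated])
  qed
  then have "f - g = 0"
    using f g e_mem by (intro complete_e) (auto simp: ip.diff_left)
  then have "f = g" by simp
  with weak[OF h] have "(\<lambda>k. ip (P k) h) \<longlonglongrightarrow> ip f h" by simp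
  then show ?thesis
    unfolding P_def sums_def using ip.projection_left[OF e _ _ h] by simp
qed

text \<open>The Parseval identity for \<open>k = form_kernel q x\<close> writes \<open>r k k\<close> as the sum over \<open>i\<close> of
  \<open>ip k (e i)\<close> times the conjugate of \<open>r k (e i)\<close>. If \<open>G i\<close> and \<open>S i\<close> represent \<open>ip \<cdot> (e i)\<close> and
  \<open>r \<cdot> (e i)\<close> with respect to \<open>q\<close>, the factors are \<open>cnj (G i x)\<close> and \<open>S i x\<close> by the reproducing
  property, and functions in \<open>H\<close> are measurable. For \<open>r = q\<close> and \<open>r = l2_ip \<mu>\<close> the result is
  the diagonal of the kernel and the square of its norm in \<open>L\<^sub>2\<close>.\<close>

lemma form_kernel_measurable:
  assumes q: "coercive_form q" and r: "bounded_form r" and pos: "\<And>f. f \<in> H \<Longrightarrow> 0 \<le> Re (r f f)"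
  shows "(\<lambda>x. Re (r (form_kernel q x) (form_kernel q x))) \<in> borel_measurable \<mu>"
proof -
  interpret q: hermitian_form H q using q by (rule coercive_form_hermitian)
  interpret r: hermitian_form H r using r by (simp add: bounded_form_def)
  obtain e where e: "ip.orthonormal (UNIV :: nat set) e"
    and complete_e: "\<And>f. f \<in> H \<Longrightarrow> (\<And>i. ip f (e i) = 0) \<Longrightarrow> f = 0"
    using exists_countable_complete_orthonormal by blast
  have e_mem: "e i \<in> H" for i using e by (auto simp: ip.orthonormal_def)
  have "\<exists>h\<in>H. \<forall>f\<in>H. q f h = r f (e i)" for i
    using Riesz_form[OF q r pos e_mem[of i]] by metis
  then obtain S where S: "\<And>i. S i \<in> H" "\<And>i f. f \<in> H \<Longrightarrow> q f (S i) = r f (e i)" by metis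
  have "\<exists>h\<in>H. \<forall>f\<in>H. q f h = ip f (e i)" for i
    using Riesz_form[OF q bounded_form_ip ip_nonneg e_mem[of i]] by metis
  then obtain G where G: "\<And>i. G i \<in> H" "\<And>i f. f \<in> H \<Longrightarrow> q f (G i) = ip f (e i)" by metis
  have [measurable]: "S i \<in> borel_measurable \<mu>" "G i \<in> borel_measurable \<mu>" for i
    using S(1) G(1) in_L2 L2_spaceD(1) by blast+
  have "Re (r (form_kernel q x) (form_kernel q x)) = Re (\<Sum>i. cnj (G i x) * S i x)"
    if x: "x \<in> space \<mu>" for x
  proof -
    let ?k = "form_kernel q x"
    note k = form_kernel[OF q x]
    obtain h where h: "h \<in> H" "\<And>f. f \<in> H \<Longrightarrow> ip f h = r f ?k"
      using Riesz_form[OF coercive_form_ip r pos k(1)] by metis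
    have 1: "ip ?k (e i) = cnj (G i x)" for i
      using G(2)[OF k(1), of i] q.herm[OF G(1) k(1), of i] k(2)[OF G(1)] by simp
    have 2: "ip (e i) h = S i x" for i
    proof -
      have "ip (e i) h = cnj (r ?k (e i))" using h(2)[OF e_mem] r.herm[OF k(1) e_mem] by simp
      also have "\<dots> = cnj (q ?k (S i))" using S(2)[OF k(1)] by simp
      also have "\<dots> = q (S i) ?k" using q.herm[OF k(1) S(1)] by simp
      finally show ?thesis using k(2)[OF S(1)] by simp
    qed
    have "(\<lambda>i. cnj (G i x) * S i x) sums ip ?k h"
      using Parseval[OF e complete_e k(1) h(1)] by (simp add: 1 2)
    then show ?thesis using h(2)[OF k(1)] by (simp add: sums_iff)
  qed
  then show ?thesis by (subst measurable_cong) auto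
qed

end

section \<open>The trace of a form, and how it changes\<close>

text \<open>The pointwise inequality says that the polynomial \<open>b x * s\<^sup>2 + 2 * a x * s + c x\<close> in \<open>s\<close> is
  nonnegative, and this is preserved by integration.\<close>

lemma integral_Cauchy_Schwarz_pointwise:
  fixes a b c :: "'a \<Rightarrow> real"
  assumes int: "integrable M a" "integrable M b" "integrable M c"
    and b: "\<And>x. x \<in> space M \<Longrightarrow> 0 \<le> b x" and c: "\<And>x. x \<in> space M \<Longrightarrow> 0 \<le> c x"
    and le: "\<And>x. x \<in> space M \<Longrightarrow> (a x)\<^sup>2 \<le> b x * c x"
  shows "(\<integral>x. a x \<partial>M)\<^sup>2 \<le> (\<integral>x. b x \<partial>M) * (\<integral>x. c x \<partial>M)"
proof (rule quadratic_nonneg_imp_discriminant)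
  show "0 \<le> (\<integral>x. b x \<partial>M)" using b by (rule Bochner_Integration.integral_nonneg)
  fix s :: real
  have pointwise: "0 \<le> b x * s\<^sup>2 + 2 * a x * s + c x" if x: "x \<in> space M" for x
  proof (cases "b x = 0")
    case True
    then show ?thesis using le[OF x] c[OF x] by simp
  next
    case False
    then have "0 < b x" using b[OF x] by simp
    have "0 \<le> (b x * s + a x)\<^sup>2 + (b x * c x - (a x)\<^sup>2)" using le[OF x] by simp
    also have "\<dots> = b x * (b x * s\<^sup>2 + 2 * a x * s + c x)" by (simp add: power2_eq_square algebra_simps)
    finally show ?thesis using \<open>0 < b x\<close> by (simp add: zero_le_mult_iff)
  qed
  have "0 \<le> (\<integral>x. b x * s\<^sup>2 + 2 * a x * s + c x \<partial>M)"
    using pointwise by (rule Bochner_Integration.integral_nonneg)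
  also have "\<dots> = (\<integral>x. b x \<partial>M) * s\<^sup>2 + 2 * (\<integral>x. a x \<partial>M) * s + (\<integral>x. c x \<partial>M)"
    using int by simp
  finally show "0 \<le> (\<integral>x. b x \<partial>M) * s\<^sup>2 + 2 * (\<integral>x. a x \<partial>M) * s + (\<integral>x. c x \<partial>M)" .
qed

definition shift_form :: "'a measure \<Rightarrow> real \<Rightarrow> (('a \<Rightarrow> complex) \<Rightarrow> ('a \<Rightarrow> complex) \<Rightarrow> complex) \<Rightarrow>
    ('a \<Rightarrow> complex) \<Rightarrow> ('a \<Rightarrow> complex) \<Rightarrow> complex" where
  "shift_form \<mu> d q = (\<lambda>f g. q f g + of_real d * l2_ip \<mu> f g)"

definition add_evaluation :: "real \<Rightarrow> 'a \<Rightarrow> (('a \<Rightarrow> complex) \<Rightarrow> ('a \<Rightarrow> complex) \<Rightarrow> complex) \<Rightarrow>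
    ('a \<Rightarrow> complex) \<Rightarrow> ('a \<Rightarrow> complex) \<Rightarrow> complex" where
  "add_evaluation a x q = (\<lambda>f g. q f g + of_real a * (f x * cnj (g x)))"

lemma Re_shift_form: "Re (shift_form \<mu> d q f f) = Re (q f f) + d * (L2_norm \<mu> f)\<^sup>2"
  by (simp add: shift_form_def Re_l2_ip_self del: of_real_power)

lemma Re_add_evaluation: "Re (add_evaluation a x q f f) = Re (q f f) + a * (cmod (f x))\<^sup>2"
  unfolding add_evaluation_def complex_norm_square[symmetric]
  by (simp del: of_real_power)

context L2_rkhs
begin

definition form_diagonal where "form_diagonal q x = Re (form_kernel q x x)"

definition form_trace where "form_trace q = (\<integral>x. form_diagonal q x \<partial>\<mu>)"

definition kernel_L2 where "kernel_L2 q x = (L2_norm \<mu> (form_kernel q x))\<^sup>2"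

lemma kernel_L2_nonneg [simp]: "0 \<le> kernel_L2 q x"
  by (simp add: kernel_L2_def)

lemma form_kernel_self:
  assumes "coercive_form q" and "x \<in> space \<mu>"
  shows "q (form_kernel q x) (form_kernel q x) = of_real (form_diagonal q x)"
    and "form_kernel q x x = of_real (form_diagonal q x)"
proof -
  interpret q: hermitian_form H q using assms(1) by (rule coercive_form_hermitian)
  show *: "q (form_kernel q x) (form_kernel q x) = of_real (form_diagonal q x)"
    using q.diagonal_real[OF form_kernel(1)[OF assms]] form_kernel[OF assms]
    by (simp add: form_diagonal_def)
  then show "form_kernel q x x = of_real (form_diagonal q x)"
    using form_kernel[OF assms] by simp
qed

lemma form_diagonal_nonneg:
  assumes "coercive_form q" and "x \<in> space \<mu>"
  shows "0 \<le> form_diagonal q x"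
  using coercive_form_nonneg[OF assms(1) form_kernel(1)[OF assms]] form_kernel_self(1)[OF assms]
  by simp

lemma form_evaluation_bound:
  assumes q: "coercive_form q" and x: "x \<in> space \<mu>" and f: "f \<in> H"
  shows "(cmod (f x))\<^sup>2 \<le> Re (q f f) * form_diagonal q x"
proof -
  interpret q: hermitian_form H q using q by (rule coercive_form_hermitian)
  show ?thesis
    using q.Cauchy_Schwarz[OF coercive_form_nonneg[OF q] f form_kernel(1)[OF q x]]
      form_kernel(2)[OF q x f] form_kernel_self(1)[OF q x] by simp
qed

lemma form_diagonal_le:
  assumes q: "coercive_form q" and x: "x \<in> space \<mu>"
    and a: "0 < a" "\<And>f. f \<in> H \<Longrightarrow> a * Re (ip f f) \<le> Re (q f f)"
  shows "form_diagonal q x \<le> Re (K x x) / a"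
proof (cases "form_diagonal q x = 0")
  case True
  then show ?thesis using kernel_diagonal_nonneg[OF x] a(1) by simp
next
  case False
  then have pos: "0 < form_diagonal q x" using form_diagonal_nonneg[OF q x] by simp
  note k = form_kernel(1)[OF q x]
  have "(form_diagonal q x)\<^sup>2 \<le> Re (ip (form_kernel q x) (form_kernel q x)) * Re (K x x)"
    using evaluation_bound[OF x k] by (simp add: form_kernel_self(2)[OF q x])
  also have "\<dots> \<le> (form_diagonal q x / a) * Re (K x x)"
    using a(2)[OF k] a(1) kernel_diagonal_nonneg[OF x] form_kernel_self(1)[OF q x]
    by (intro mult_right_mono) (auto simp: field_simps)
  finally have "form_diagonal q x * form_diagonal q x \<le> form_diagonal q x * (Re (K x x) / a)"
    by (simp add: power2_eq_square)
  then show ?thesis using pos by (rule mult_left_le_imp_le)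
qed

lemma form_diagonal_integrable:
  assumes q: "coercive_form q"
  shows "integrable \<mu> (form_diagonal q)"
proof -
  obtain a where a: "0 < a" "\<And>f. f \<in> H \<Longrightarrow> a * Re (ip f f) \<le> Re (q f f)"
    using q unfolding coercive_form_def by blast
  have "(\<lambda>x. Re (q (form_kernel q x) (form_kernel q x))) \<in> borel_measurable \<mu>"
    using q coercive_form_nonneg[OF q] unfolding coercive_form_def
    by (intro form_kernel_measurable[OF q]) auto
  then have meas: "form_diagonal q \<in> borel_measurable \<mu>"
    by (subst (asm) measurable_cong[where g = "form_diagonal q"]) (simp_all add: form_kernel_self[OF q])
  have le: "norm (form_diagonal q x) \<le> norm (Re (K x x) / a)" if "x \<in> space \<mu>" for x
    using form_diagonal_le[OF q that a] form_diagonal_nonneg[OF q that]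
      kernel_diagonal_nonneg[OF that] a(1) by simp
  show ?thesis
  proof (rule Bochner_Integration.integrable_bound)
    show "integrable \<mu> (\<lambda>x. Re (K x x) / a)" using trace_finite by simp
    show "AE x in \<mu>. norm (form_diagonal q x) \<le> norm (Re (K x x) / a)"
      using le by (rule AE_I2)
  qed (rule meas)
qed

lemma form_trace_le:
  assumes q: "coercive_form q" and a: "0 < a" "\<And>f. f \<in> H \<Longrightarrow> a * Re (ip f f) \<le> Re (q f f)"
  shows "form_trace q \<le> kernel_trace \<mu> K / a"
proof -
  have "form_trace q \<le> (\<integral>x. Re (K x x) / a \<partial>\<mu>)"
    unfolding form_trace_def using form_diagonal_integrable[OF q] trace_finite form_diagonal_le[OF q _ a]
    by (intro integral_mono) auto
  then show ?thesis by (simp add: kernel_trace_def)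
qed

text \<open>This is how a bound on the trace keeps a form positive: \<open>q\<close> stays coercive after subtracting
  less than \<open>1 / form_trace q\<close> times the square of the norm of \<open>L\<^sub>2\<close>.\<close>

lemma L2_norm_le_form_trace:
  assumes q: "coercive_form q" and f: "f \<in> H"
  shows "(L2_norm \<mu> f)\<^sup>2 \<le> Re (q f f) * form_trace q"
proof -
  have "(\<integral>x. (cmod (f x))\<^sup>2 \<partial>\<mu>) \<le> (\<integral>x. Re (q f f) * form_diagonal q x \<partial>\<mu>)"
    using f in_L2 form_diagonal_integrable[OF q] form_evaluation_bound[OF q _ f]
    by (intro integral_mono) (auto dest: L2_spaceD(2))
  then show ?thesis by (simp add: L2_norm_square form_trace_def)
qed

lemma kernel_L2_integrable:
  assumes q: "coercive_form q"
  shows "integrable \<mu> (kernel_L2 q)"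
proof (rule Bochner_Integration.integrable_bound)
  show "integrable \<mu> (\<lambda>x. form_diagonal q x * form_trace q)"
    using form_diagonal_integrable[OF q] by simp
  show "kernel_L2 q \<in> borel_measurable \<mu>"
    using form_kernel_measurable[OF q bounded_form_l2]
    unfolding Re_l2_ip_self kernel_L2_def by (simp add: eta_contract_eq)
  have "kernel_L2 q x \<le> form_diagonal q x * form_trace q" if "x \<in> space \<mu>" for x
    using L2_norm_le_form_trace[OF q form_kernel(1)[OF q that]] form_kernel_self(1)[OF q that]
    by (simp add: kernel_L2_def)
  then show "AE x in \<mu>. norm (kernel_L2 q x) \<le> norm (form_diagonal q x * form_trace q)"
    by (intro AE_I2) (metis abs_ge_self abs_of_nonneg kernel_L2_nonneg order_trans real_norm_def)
qed

text \<open>The injectivity of \<open>H \<rightarrow> L\<^sub>2\<close> enters here: a kernel function that is zero almost everywhere is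
  zero.\<close>

lemma kernel_L2_eq_0_iff:
  assumes "coercive_form q" and "x \<in> space \<mu>"
  shows "kernel_L2 q x = 0 \<longleftrightarrow> form_diagonal q x = 0"
proof
  assume "kernel_L2 q x = 0"
  then have "form_kernel q x = 0"
    using L2_definite form_kernel(1)[OF assms] unfolding kernel_L2_def by auto
  then show "form_diagonal q x = 0" by (simp add: form_diagonal_def)
next
  assume "form_diagonal q x = 0"
  then have "form_kernel q x = 0"
    using coercive_form_pos[OF assms(1) form_kernel(1)[OF assms]] form_kernel_self(1)[OF assms] by auto
  then show "kernel_L2 q x = 0" by (simp add: kernel_L2_def L2_norm_def)
qed

lemma kernel_L2_integral_pos:
  assumes q: "coercive_form q"
  shows "0 < (\<integral>x. kernel_L2 q x \<partial>\<mu>)"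
proof (rule ccontr)
  assume "\<not> ?thesis"
  moreover have "0 \<le> (\<integral>x. kernel_L2 q x \<partial>\<mu>)" by (intro Bochner_Integration.integral_nonneg) simp
  ultimately have "(\<integral>x. kernel_L2 q x \<partial>\<mu>) = 0" by linarith
  then have "AE x in \<mu>. kernel_L2 q x = 0"
    using integral_nonneg_eq_0_iff_AE[OF kernel_L2_integrable[OF q]] by simp
  then have "AE x in \<mu>. form_diagonal q x = 0"
    by (rule AE_mp) (intro AE_I2, use kernel_L2_eq_0_iff[OF q] in auto)
  then have "form_trace q = 0" unfolding form_trace_def by (rule integral_eq_zero_AE)
  obtain f where f: "f \<in> H" "f \<noteq> 0" using nontrivial ip.mem(4) by blast
  then have "(L2_norm \<mu> f)\<^sup>2 \<le> 0" using L2_norm_le_form_trace[OF q f(1)] \<open>form_trace q = 0\<close> by simp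
  then show False using L2_definite[OF f] by simp
qed

text \<open>Let \<open>R\<close> and \<open>R1\<close> be the operators on \<open>L\<^sub>2\<close> with the kernels of \<open>q\<close> and \<open>q1\<close>. The first two
  inequalities are pointwise versions of consequences of \<open>R - R1 = d * R * R1\<close>; integrated, they give
  \<open>d * tr (R1\<^sup>2) \<le> tr (R - R1)\<close> and the inequality of Cauchy and Schwarz
  \<open>(tr (R * R1))\<^sup>2 \<le> tr (R\<^sup>2 * R1) * tr R1\<close>. All follow from computing \<open>q u u\<close>, \<open>q1 u u\<close> and \<open>u x\<close>
  for the difference \<open>u\<close> of the two kernel functions at \<open>x\<close>.\<close>

lemma shift_form_kernel:
  fixes q and x and d :: real
  defines "q1 \<equiv> shift_form \<mu> d q"
  defines "D \<equiv> form_diagonal q x - form_diagonal q1 x"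
  assumes q: "coercive_form q" and q1: "coercive_form q1" and d: "0 < d" and x: "x \<in> space \<mu>"
  shows "d * kernel_L2 q1 x \<le> D"
    and "D\<^sup>2 \<le> (d * kernel_L2 q x - D) * form_diagonal q1 x"
    and "0 \<le> d * kernel_L2 q x - D"
proof -
  interpret q: hermitian_form H q using q by (rule coercive_form_hermitian)
  interpret q1: hermitian_form H q1 using q1 by (rule coercive_form_hermitian)
  interpret l: hermitian_form H "l2_ip \<mu>" by (rule hermitian_form_l2)
  define k where "k = form_kernel q x"
  define k1 where "k1 = form_kernel q1 x"
  have k: "k \<in> H" "\<And>f. f \<in> H \<Longrightarrow> q f k = f x" using form_kernel[OF q x] by (simp_all add: k_def)
  have k1: "k1 \<in> H" "\<And>f. f \<in> H \<Longrightarrow> q1 f k1 = f x" using form_kernel[OF q1 x] by (simp_all add: k1_def)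
  have L2: "Re (l2_ip \<mu> k k) = kernel_L2 q x" "Re (l2_ip \<mu> k1 k1) = kernel_L2 q1 x"
    by (simp_all add: kernel_L2_def k_def k1_def Re_l2_ip_self)
  define u where "u = k - k1"
  have u: "u \<in> H" using k(1) k1(1) by (simp add: u_def)
  have ux: "u x = of_real D"
    using form_kernel_self(2)[OF q x] form_kernel_self(2)[OF q1 x]
    by (simp add: u_def k_def k1_def D_def)
  have q1_eq: "q1 f g = q f g + of_real d * l2_ip \<mu> f g" for f g by (simp add: q1_def shift_form_def)
  have q1u: "q1 f u = of_real d * l2_ip \<mu> f k" if f: "f \<in> H" for f
    using f k k1 by (simp add: u_def q1.diff_right) (simp add: q1_eq k(2))
  have qu: "q f u = of_real d * l2_ip \<mu> f k1" if f: "f \<in> H" for f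
    using f k k1 k1(2)[OF f] by (simp add: u_def q.diff_right q1_eq algebra_simps)
  have "of_real D = of_real d * l2_ip \<mu> k1 k"
    using q1u[OF k1(1)] q1.herm[OF u k1(1)] k1(2)[OF u] ux by simp
  then have "Re (of_real D) = Re (of_real d * l2_ip \<mu> k1 k)" by (rule arg_cong)
  then have D: "D = d * Re (l2_ip \<mu> k1 k)" by simp
  have kk1: "Re (l2_ip \<mu> k k1) = Re (l2_ip \<mu> k1 k)" using l.herm[OF k(1) k1(1)] by simp
  have "0 \<le> Re (q u u)" using q u by (rule coercive_form_nonneg)
  also have "\<dots> = D - d * kernel_L2 q1 x"
    unfolding qu[OF u] using k(1) k1(1) by (simp add: u_def l.diff_left L2 D kk1 algebra_simps)
  finally show "d * kernel_L2 q1 x \<le> D" by simp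
  have q1uu: "Re (q1 u u) = d * kernel_L2 q x - D"
    unfolding q1u[OF u] using k(1) k1(1) by (simp add: u_def l.diff_left L2 D algebra_simps)
  then show "0 \<le> d * kernel_L2 q x - D" using coercive_form_nonneg[OF q1 u] by simp
  show "D\<^sup>2 \<le> (d * kernel_L2 q x - D) * form_diagonal q1 x"
    using form_evaluation_bound[OF q1 x u] by (simp add: ux q1uu)
qed

lemma form_trace_shift_less:
  fixes q and d :: real
  defines "q1 \<equiv> shift_form \<mu> d q"
  assumes q: "coercive_form q" and q1: "coercive_form q1" and d: "0 < d"
  shows "d * (\<integral>x. kernel_L2 q1 x \<partial>\<mu>) \<le> form_trace q - form_trace q1"
    and "form_trace q1 < form_trace q"
proof -
  note int = form_diagonal_integrable[OF q] form_diagonal_integrable[OF q1] kernel_L2_integrable[OF q1]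
  have "(\<integral>x. d * kernel_L2 q1 x \<partial>\<mu>) \<le> (\<integral>x. form_diagonal q x - form_diagonal q1 x \<partial>\<mu>)"
    using int shift_form_kernel(1)[OF q _ d] q1 unfolding q1_def
    by (intro integral_mono) auto
  then show *: "d * (\<integral>x. kernel_L2 q1 x \<partial>\<mu>) \<le> form_trace q - form_trace q1"
    using int by (simp add: form_trace_def)
  show "form_trace q1 < form_trace q"
    using * mult_pos_pos[OF d kernel_L2_integral_pos[OF q1]] by linarith
qed

lemma bounded_form_shift: "bounded_form q \<Longrightarrow> bounded_form (shift_form \<mu> d q)"
  unfolding shift_form_def using bounded_form_l2 by (intro bounded_form_add_scaled)

lemma bounded_form_add_evaluation:
  "bounded_form q \<Longrightarrow> x \<in> space \<mu> \<Longrightarrow> bounded_form (add_evaluation a x q)"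
  unfolding add_evaluation_def using bounded_form_evaluation by (intro bounded_form_add_scaled)

lemma coercive_form_shift:
  assumes q: "coercive_form q" and d: "0 \<le> d"
  shows "coercive_form (shift_form \<mu> d q)"
proof (rule coercive_form_minorant[OF q])
  show "bounded_form (shift_form \<mu> d q)"
    using q bounded_form_shift by (simp add: coercive_form_def)
  show "0 < (1::real)" by simp
  show "1 * Re (q f f) \<le> Re (shift_form \<mu> d q f f)" for f
    using d by (simp add: Re_shift_form)
qed

lemma coercive_form_shift_neg:
  assumes q: "coercive_form q" and d: "0 \<le> d" "d * form_trace q < 1"
  shows "coercive_form (shift_form \<mu> (- d) q)"
proof (rule coercive_form_minorant[OF q])
  show "bounded_form (shift_form \<mu> (- d) q)"
    using q bounded_form_shift by (simp add: coercive_form_def)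
  show "0 < 1 - d * form_trace q" using d by simp
  show "(1 - d * form_trace q) * Re (q f f) \<le> Re (shift_form \<mu> (- d) q f f)" if "f \<in> H" for f
    using mult_left_mono[OF L2_norm_le_form_trace[OF q that] d(1)]
    by (simp add: Re_shift_form algebra_simps)
qed

lemma coercive_form_add_evaluation:
  assumes q: "coercive_form q" and x: "x \<in> space \<mu>" and a: "0 < 1 + a * form_diagonal q x"
  shows "coercive_form (add_evaluation a x q)"
proof (rule coercive_form_minorant[OF q])
  show "bounded_form (add_evaluation a x q)"
    using q x bounded_form_add_evaluation by (simp add: coercive_form_def)
  show "0 < min 1 (1 + a * form_diagonal q x)" using a by simp
  show "min 1 (1 + a * form_diagonal q x) * Re (q f f) \<le> Re (add_evaluation a x q f f)"
    if f: "f \<in> H" for f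
  proof (cases "0 \<le> a")
    case True
    have "min 1 (1 + a * form_diagonal q x) * Re (q f f) \<le> 1 * Re (q f f)"
      using coercive_form_nonneg[OF q f] by (intro mult_right_mono) auto
    also have "\<dots> \<le> Re (add_evaluation a x q f f)" using True by (simp add: Re_add_evaluation)
    finally show ?thesis .
  next
    case False
    have "min 1 (1 + a * form_diagonal q x) * Re (q f f) \<le> (1 + a * form_diagonal q x) * Re (q f f)"
      using coercive_form_nonneg[OF q f] by (intro mult_right_mono) auto
    also have "\<dots> \<le> Re (add_evaluation a x q f f)"
      using mult_left_mono_neg[OF form_evaluation_bound[OF q x f], of a] False
      by (simp add: Re_add_evaluation algebra_simps)
    finally show ?thesis .
  qed
qed

text \<open>The formula of Sherman and Morrison for the inverse of a rank-one perturbation.\<close>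

lemma form_diagonal_add_evaluation:
  fixes a :: real
  assumes q: "coercive_form q" and x: "x \<in> space \<mu>" and y: "y \<in> space \<mu>"
    and a: "0 < 1 + a * form_diagonal q x"
  shows "form_diagonal (add_evaluation a x q) y
    = form_diagonal q y - a / (1 + a * form_diagonal q x) * (cmod (form_kernel q x y))\<^sup>2"
proof -
  interpret q: hermitian_form H q using q by (rule coercive_form_hermitian)
  define s where "s = 1 + a * form_diagonal q x"
  have s: "s \<noteq> 0" using a by (simp add: s_def)
  define ky where "ky = form_kernel q y"
  define kx where "kx = form_kernel q x"
  have ky: "ky \<in> H" "\<And>f. f \<in> H \<Longrightarrow> q f ky = f y" using form_kernel[OF q y] by (simp_all add: ky_def)
  have kx: "kx \<in> H" "\<And>f. f \<in> H \<Longrightarrow> q f kx = f x" using form_kernel[OF q x] by (simp_all add: kx_def)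
  have kxx: "kx x = of_real (form_diagonal q x)" using form_kernel_self(2)[OF q x] by (simp add: kx_def)
  have sym: "ky x = cnj (kx y)" using kx(2)[OF ky(1)] ky(2)[OF kx(1)] q.herm[OF kx(1) ky(1)] by simp
  define c where "c = - (of_real a * ky x) / of_real s"
  have c: "c * of_real s = - (of_real a * ky x)" using s by (simp add: c_def)
  have "form_kernel (add_evaluation a x q) y = ky + scale_fun c kx"
  proof (rule form_kernel_unique[OF coercive_form_add_evaluation[OF q x a] y])
    show "ky + scale_fun c kx \<in> H" using kx ky by simp
    fix f assume f: "f \<in> H"
    have "q f (ky + scale_fun c kx) = f y + cnj c * f x"
      using f kx ky by (simp add: q.add_right q.scale_right)
    then have "add_evaluation a x q f (ky + scale_fun c kx)
      = f y + f x * cnj (c + of_real a * (ky x + c * of_real (form_diagonal q x)))"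
      by (simp add: add_evaluation_def kxx scale_fun_def algebra_simps)
    also have "c + of_real a * (ky x + c * of_real (form_diagonal q x)) = c * of_real s + of_real a * ky x"
      by (simp add: s_def algebra_simps)
    also have "\<dots> = 0" using c by simp
    finally show "add_evaluation a x q f (ky + scale_fun c kx) = f y"
      by (simp only: complex_cnj_zero mult_zero_right add_0_right)
  qed
  then have "form_diagonal (add_evaluation a x q) y = Re (ky y + c * kx y)"
    by (simp add: form_diagonal_def scale_fun_def)
  also have "c * kx y = - of_real (a / s) * (kx y * cnj (kx y))" by (simp add: c_def sym)
  also have "\<dots> = of_real (- (a / s) * (cmod (kx y))\<^sup>2)"
    by (simp only: complex_norm_square[symmetric] of_real_mult of_real_minus)
  finally show ?thesis by (simp add: form_diagonal_def ky_def kx_def s_def del: of_real_power)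
qed

lemma form_trace_add_evaluation:
  fixes a :: real
  assumes q: "coercive_form q" and x: "x \<in> space \<mu>" and a: "0 < 1 + a * form_diagonal q x"
  shows "form_trace (add_evaluation a x q)
    = form_trace q - a * kernel_L2 q x / (1 + a * form_diagonal q x)"
proof -
  have "form_kernel q x \<in> L2_space \<mu>" using form_kernel(1)[OF q x] in_L2 by blast
  then have int: "integrable \<mu> (\<lambda>y. (cmod (form_kernel q x y))\<^sup>2)" by (rule L2_spaceD)
  have "form_trace (add_evaluation a x q)
    = (\<integral>y. form_diagonal q y - a / (1 + a * form_diagonal q x) * (cmod (form_kernel q x y))\<^sup>2 \<partial>\<mu>)"
    unfolding form_trace_def
    using form_diagonal_add_evaluation[OF q x _ a] by (intro Bochner_Integration.integral_cong) auto
  then show ?thesis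
    using form_diagonal_integrable[OF q] int
    by (simp add: form_trace_def kernel_L2_def L2_norm_square)
qed

text \<open>Let \<open>k\<^sub>x\<close> be the kernel of the shifted form. The shift lowers the trace by \<open>D\<close>, and subtracting
  \<open>w * |f x|\<^sup>2\<close> raises it by \<open>w * \<parallel>k\<^sub>x\<parallel>\<^sub>2\<^sup>2 / (1 - w * k\<^sub>x x)\<close>. Solving for \<open>w\<close> shows that the trace does not increase if
  \<open>w * (\<parallel>k\<^sub>x\<parallel>\<^sub>2\<^sup>2 / D + k\<^sub>x x) \<le> 1\<close>. The integral of \<open>\<parallel>k\<^sub>x\<parallel>\<^sub>2\<^sup>2\<close> is at most \<open>D / d\<close>.\<close>

lemma upper_barrier_step:
  assumes q: "coercive_form q" and d: "0 < d"
  obtains U where "integrable \<mu> U" and "(\<integral>x. U x \<partial>\<mu>) \<le> 1 / d + form_trace q"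
    and "\<And>x. x \<in> space \<mu> \<Longrightarrow> 0 \<le> U x"
    and "\<And>x w. \<lbrakk>x \<in> space \<mu>; 0 < w; w * U x \<le> 1\<rbrakk> \<Longrightarrow>
      coercive_form (add_evaluation (- w) x (shift_form \<mu> d q)) \<and>
      form_trace (add_evaluation (- w) x (shift_form \<mu> d q)) \<le> form_trace q"
proof
  define q1 where "q1 = shift_form \<mu> d q"
  have q1: "coercive_form q1" unfolding q1_def using q d by (intro coercive_form_shift) auto
  note shift = form_trace_shift_less[OF q _ d, folded q1_def, OF q1]
  define D where "D = form_trace q - form_trace q1"
  have D: "0 < D" using shift by (simp add: D_def)
  define U where "U x = kernel_L2 q1 x / D + form_diagonal q1 x" for x
  show "integrable \<mu> U"
    unfolding U_def using kernel_L2_integrable[OF q1] form_diagonal_integrable[OF q1] by simp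
  have "(\<integral>x. U x \<partial>\<mu>) = (\<integral>x. kernel_L2 q1 x \<partial>\<mu>) / D + form_trace q1"
    unfolding U_def form_trace_def using kernel_L2_integrable[OF q1] form_diagonal_integrable[OF q1] by simp
  also have "\<dots> \<le> 1 / d + form_trace q"
    using shift D d by (intro add_mono) (simp_all add: D_def field_simps)
  finally show "(\<integral>x. U x \<partial>\<mu>) \<le> 1 / d + form_trace q" .
  show U_nonneg: "0 \<le> U x" if "x \<in> space \<mu>" for x
    unfolding U_def using D form_diagonal_nonneg[OF q1 that] by simp
  fix x :: 'a and w :: real assume x: "x \<in> space \<mu>" and w: "0 < w" "w * U x \<le> 1"
  have wU: "w * kernel_L2 q1 x / D + w * form_diagonal q1 x \<le> 1"
    using w(2) by (simp add: U_def algebra_simps)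
  \<comment> \<open>If \<open>kernel_L2 q1 x = 0\<close>, all functions of \<open>H\<close> vanish at \<open>x\<close>; otherwise the first summand of
    \<open>w * U x\<close> is positive.\<close>
  have s: "0 < 1 + (- w) * form_diagonal q1 x"
  proof (cases "kernel_L2 q1 x = 0")
    case True
    then show ?thesis using kernel_L2_eq_0_iff[OF q1 x] by simp
  next
    case False
    then have "0 < kernel_L2 q1 x" using kernel_L2_nonneg[of q1 x] by linarith
    then have "0 < w * kernel_L2 q1 x / D" using w(1) D by simp
    then show ?thesis using wU by simp
  qed
  have "w * kernel_L2 q1 x \<le> D * (1 - w * form_diagonal q1 x)"
    using wU D by (simp add: field_simps)
  then have "w * kernel_L2 q1 x / (1 - w * form_diagonal q1 x) \<le> D"
    using s by (simp add: field_simps)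
  then show "coercive_form (add_evaluation (- w) x (shift_form \<mu> d q)) \<and>
      form_trace (add_evaluation (- w) x (shift_form \<mu> d q)) \<le> form_trace q"
    using coercive_form_add_evaluation[OF q1 x s] form_trace_add_evaluation[OF q1 x s]
    by (simp add: D_def q1_def[symmetric])
qed

text \<open>Now the shift raises the trace by \<open>D\<close>, and adding \<open>w * |f x|\<^sup>2\<close> has to compensate for it. The
  bound on the integral of \<open>L\<close> is more delicate than in the upper case: \<open>\<integral> \<parallel>k\<^sub>x\<parallel>\<^sub>2\<^sup>2 d\<mu> \<ge> D / d\<close> alone
  loses the summand \<open>D\<close>, which the Cauchy-Schwarz inequality recovers because \<open>d * form_trace p \<le> 1\<close>.\<close>

lemma lower_barrier_step:
  assumes p: "coercive_form p" and d: "0 < d" "d * form_trace p < 1"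
  obtains L where "integrable \<mu> L" and "1 / d - form_trace p \<le> (\<integral>x. L x \<partial>\<mu>)"
    and "\<And>x w. \<lbrakk>x \<in> space \<mu>; 0 < w; 1 \<le> w * L x\<rbrakk> \<Longrightarrow>
      coercive_form (add_evaluation w x (shift_form \<mu> (- d) p)) \<and>
      form_trace (add_evaluation w x (shift_form \<mu> (- d) p)) \<le> form_trace p"
proof
  define p1 where "p1 = shift_form \<mu> (- d) p"
  have p1: "coercive_form p1" unfolding p1_def using p d by (intro coercive_form_shift_neg) auto
  have p_eq: "p = shift_form \<mu> d p1" by (simp add: p1_def shift_form_def)
  have p': "coercive_form (shift_form \<mu> d p1)" using p p_eq by simp
  have less: "form_trace p < form_trace p1" using form_trace_shift_less(2)[OF p1 p' d(1)] p_eq by simp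
  define D where "D = form_trace p1 - form_trace p"
  have D: "0 < D" using less by (simp add: D_def)
  define S where "S = (\<integral>x. kernel_L2 p1 x \<partial>\<mu>)"
  note int = form_diagonal_integrable[OF p] form_diagonal_integrable[OF p1] kernel_L2_integrable[OF p1]
  note kernels = shift_form_kernel[OF p1 p' d(1), folded p_eq]
  have "(\<integral>x. form_diagonal p1 x - form_diagonal p x \<partial>\<mu>)\<^sup>2
    \<le> (\<integral>x. d * kernel_L2 p1 x - (form_diagonal p1 x - form_diagonal p x) \<partial>\<mu>) * (\<integral>x. form_diagonal p x \<partial>\<mu>)"
    using int kernels(2,3) form_diagonal_nonneg[OF p]
    by (intro integral_Cauchy_Schwarz_pointwise) auto
  then have CS: "D\<^sup>2 \<le> (d * S - D) * form_trace p"
    using int by (simp add: D_def S_def form_trace_def)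
  have "0 \<le> (\<integral>x. d * kernel_L2 p1 x - (form_diagonal p1 x - form_diagonal p x) \<partial>\<mu>)"
    using kernels(3) by (rule Bochner_Integration.integral_nonneg)
  then have nonneg: "0 \<le> d * S - D" using int by (simp add: D_def S_def form_trace_def)
  have "d * D\<^sup>2 \<le> (d * S - D) * (d * form_trace p)"
    using mult_left_mono[OF CS, of d] d(1) by (simp add: algebra_simps)
  also have "\<dots> \<le> (d * S - D) * 1" using nonneg d(2) by (intro mult_left_mono) auto
  finally have key: "1 / d + D \<le> S / D"
    using D d(1) by (simp add: field_simps power2_eq_square)
  define L where "L x = kernel_L2 p1 x / D - form_diagonal p1 x" for x
  show "integrable \<mu> L" unfolding L_def using int by simp
  have "(\<integral>x. L x \<partial>\<mu>) = S / D - form_trace p1"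
    unfolding L_def form_trace_def S_def using int by simp
  then show "1 / d - form_trace p \<le> (\<integral>x. L x \<partial>\<mu>)" using key by (simp add: D_def)
  fix x :: 'a and w :: real assume x: "x \<in> space \<mu>" and w: "0 < w" "1 \<le> w * L x"
  have s: "0 < 1 + w * form_diagonal p1 x"
    using w(1) mult_nonneg_nonneg[OF _ form_diagonal_nonneg[OF p1 x], of w] by simp
  have "D * (1 + w * form_diagonal p1 x) \<le> w * kernel_L2 p1 x"
    using w(2) D by (simp add: L_def field_simps)
  then have "D \<le> w * kernel_L2 p1 x / (1 + w * form_diagonal p1 x)"
    using s by (simp add: field_simps)
  then show "coercive_form (add_evaluation w x (shift_form \<mu> (- d) p)) \<and>
      form_trace (add_evaluation w x (shift_form \<mu> (- d) p)) \<le> form_trace p"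
    using coercive_form_add_evaluation[OF p1 x s] form_trace_add_evaluation[OF p1 x s]
    by (simp add: D_def p1_def[symmetric])
qed

end

section \<open>Choosing the points\<close>

definition weighted_sum :: "('a \<times> real) list \<Rightarrow> ('a \<Rightarrow> complex) \<Rightarrow> real" where
  "weighted_sum S f = (\<Sum>(x, w)\<leftarrow>S. w * (cmod (f x))\<^sup>2)"

lemma weighted_sum_Nil [simp]: "weighted_sum [] f = 0"
  by (simp add: weighted_sum_def)

lemma weighted_sum_Cons [simp]: "weighted_sum ((x, w) # S) f = w * (cmod (f x))\<^sup>2 + weighted_sum S f"
  by (simp add: weighted_sum_def)

text \<open>A strategy is a condition on the weighted points chosen so far that can be kept forever: in
  every admissible state, each \<open>x\<close> may be added with any weight \<open>w\<close> for which \<open>1 / w \<le> L x\<close>, where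
  \<open>L\<close> has integral at least \<open>1\<close>. For upper strategies both inequalities are reversed.\<close>

definition lower_strategy :: "'a measure \<Rightarrow> (('a \<times> real) list \<Rightarrow> bool) \<Rightarrow> bool" where
  "lower_strategy \<mu> P \<longleftrightarrow> P [] \<and> (\<forall>S. P S \<longrightarrow>
     (\<exists>L. integrable \<mu> L \<and> 1 \<le> (\<integral>x. L x \<partial>\<mu>) \<and>
       (\<forall>x\<in>space \<mu>. \<forall>w>0. 1 \<le> w * L x \<longrightarrow> P ((x, w) # S))))"

definition upper_strategy :: "'a measure \<Rightarrow> (('a \<times> real) list \<Rightarrow> bool) \<Rightarrow> bool" where
  "upper_strategy \<mu> Q \<longleftrightarrow> Q [] \<and> (\<forall>S. Q S \<longrightarrow>
     (\<exists>U. integrable \<mu> U \<and> (\<integral>x. U x \<partial>\<mu>) \<le> 1 \<and> (\<forall>x\<in>space \<mu>. 0 \<le> U x) \<and>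
       (\<forall>x\<in>space \<mu>. \<forall>w>0. w * U x \<le> 1 \<longrightarrow> Q ((x, w) # S))))"

text \<open>If there were no such point, \<open>L \<le> U\<close> would hold almost everywhere, hence \<open>L = U\<close> by comparison of
  the integrals, and then \<open>L = 0\<close> almost everywhere, contrary to \<open>1 \<le> \<integral> L d\<mu>\<close>.\<close>

lemma exists_common_point:
  assumes L: "integrable \<mu> L" "1 \<le> (\<integral>x. L x \<partial>\<mu>)"
    and U: "integrable \<mu> U" "(\<integral>x. U x \<partial>\<mu>) \<le> 1" "\<And>x. x \<in> space \<mu> \<Longrightarrow> 0 \<le> U x"
    and Z: "Z \<in> null_sets \<mu>"
  obtains x where "x \<in> space \<mu> - Z" and "U x \<le> L x" and "(0::real) < L x"
proof (rule ccontr)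
  assume "\<not> thesis"
  then have bad: "L x < U x \<or> L x \<le> 0" if "x \<in> space \<mu> - Z" for x
    using that \<open>\<And>x. x \<in> space \<mu> - Z \<Longrightarrow> U x \<le> L x \<Longrightarrow> 0 < L x \<Longrightarrow> thesis\<close>
    by (meson linorder_not_less)
  have ae: "AE x in \<mu>. x \<in> space \<mu> - Z"
    using AE_not_in[OF Z] AE_space by eventually_elim auto
  have LU: "AE x in \<mu>. L x \<le> U x"
    using ae by eventually_elim (use bad U(3) in force)
  have "(\<integral>x. U x - L x \<partial>\<mu>) \<le> 0" using L U(1,2) by simp
  moreover have "0 \<le> (\<integral>x. U x - L x \<partial>\<mu>)"
    using LU by (intro integral_nonneg_AE) (auto elim: eventually_mono)
  ultimately have "(\<integral>x. U x - L x \<partial>\<mu>) = 0" by linarith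
  moreover have "AE x in \<mu>. 0 \<le> U x - L x" using LU by eventually_elim simp
  ultimately have "AE x in \<mu>. U x - L x = 0"
    using integral_nonneg_eq_0_iff_AE[of \<mu> "\<lambda>x. U x - L x"] L(1) U(1) by simp
  then have "AE x in \<mu>. L x = 0"
    using ae by eventually_elim (use bad U(3) in force)
  then have "(\<integral>x. L x \<partial>\<mu>) = 0" by (rule integral_eq_zero_AE)
  then show False using L(2) by simp
qed

lemma strategies_combine:
  assumes P: "lower_strategy \<mu> P" and Q: "upper_strategy \<mu> Q" and Z: "Z \<in> null_sets \<mu>"
  shows "\<exists>S. length S = n \<and> P S \<and> Q S \<and> (\<forall>(x, w)\<in>set S. x \<in> space \<mu> - Z \<and> 0 < w)"
proof (induction n)
  case 0
  then show ?case using P Q by (auto simp: lower_strategy_def upper_strategy_def)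
next
  case (Suc n)
  then obtain S where S: "length S = n" "P S" "Q S" "\<forall>(x, w)\<in>set S. x \<in> space \<mu> - Z \<and> 0 < w"
    by blast
  obtain L where L: "integrable \<mu> L" "1 \<le> (\<integral>x. L x \<partial>\<mu>)"
    "\<And>x w. x \<in> space \<mu> \<Longrightarrow> w > 0 \<Longrightarrow> 1 \<le> w * L x \<Longrightarrow> P ((x, w) # S)"
    using P S(2) unfolding lower_strategy_def by meson
  obtain U where U: "integrable \<mu> U" "(\<integral>x. U x \<partial>\<mu>) \<le> 1" "\<And>x. x \<in> space \<mu> \<Longrightarrow> 0 \<le> U x"
    "\<And>x w. x \<in> space \<mu> \<Longrightarrow> w > 0 \<Longrightarrow> w * U x \<le> 1 \<Longrightarrow> Q ((x, w) # S)"
    using Q S(3) unfolding upper_strategy_def by meson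
  obtain x where x: "x \<in> space \<mu> - Z" "U x \<le> L x" "0 < L x"
    using exists_common_point[OF L(1,2) U(1-3) Z] by blast
  have "P ((x, 1 / L x) # S)" using x by (intro L(3)) auto
  moreover have "Q ((x, 1 / L x) # S)" using x by (intro U(4)) auto
  ultimately show ?case using S x by (intro exI[of _ "(x, 1 / L x) # S"]) simp
qed

text \<open>The condition \<open>1 \<le> w * |b x|\<^sup>2\<close> makes each summand at least \<open>1\<close>. This is the optimal lower
  strategy for the line spanned by \<open>b\<close>.\<close>

lemma lower_strategy_linear:
  assumes b: "b \<in> L2_space \<mu>" and "L2_norm \<mu> b = 1"
  shows "lower_strategy \<mu> (\<lambda>S. real (length S) \<le> weighted_sum S b)"
proof -
  have "integrable \<mu> (\<lambda>x. (cmod (b x))\<^sup>2)" "1 \<le> (\<integral>x. (cmod (b x))\<^sup>2 \<partial>\<mu>)"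
    using L2_spaceD(2)[OF b] assms(2) L2_norm_square[of \<mu> b] by simp_all
  then show ?thesis
    unfolding lower_strategy_def by (auto intro!: exI[of _ "\<lambda>x. (cmod (b x))\<^sup>2"])
qed

lemma (in hilbert_function_space) bounded_form_scale:
  assumes "bounded_form q"
  shows "bounded_form (\<lambda>f g. of_real a * q f g)"
  using bounded_form_add_scaled[OF assms assms, of "a - 1"] by (simp add: algebra_simps)

context L2_rkhs
begin

lemma kernel_trace_pos: "0 < kernel_trace \<mu> K"
proof (rule ccontr)
  assume nonpos: "\<not> ?thesis"
  obtain f where f: "f \<in> H" "f \<noteq> 0" using nontrivial ip.mem(4) by blast
  have "kernel_trace \<mu> K * Re (ip f f) \<le> 0"
    using nonpos ip_nonneg[OF f(1)] by (simp add: mult_nonpos_nonneg)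
  then have "(L2_norm \<mu> f)\<^sup>2 \<le> 0" using L2_norm_le_trace[OF f(1)] by linarith
  then show False using L2_definite[OF f] by simp
qed

text \<open>Points are added with \<open>w * K x x\<close> at most the trace, so each of them contributes at most
  \<open>kernel_trace \<mu> K * \<parallel>f\<parallel>\<^sub>H\<^sup>2\<close>. For a trace close to \<open>lam\<close> this is better than a barrier.\<close>

lemma upper_strategy_linear:
  "upper_strategy \<mu> (\<lambda>S. \<forall>f\<in>H. weighted_sum S f \<le> real (length S) * kernel_trace \<mu> K * Re (ip f f))"
proof -
  let ?T = "kernel_trace \<mu> K"
  have T: "0 < ?T" by (rule kernel_trace_pos)
  have step: "w * (cmod (f x))\<^sup>2 \<le> ?T * Re (ip f f)"
    if "x \<in> space \<mu>" "0 < w" "w * (Re (K x x) / ?T) \<le> 1" "f \<in> H" for x w f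
  proof -
    have "w * (cmod (f x))\<^sup>2 \<le> w * (Re (ip f f) * Re (K x x))"
      using evaluation_bound[OF that(1,4)] that(2) by simp
    also have "\<dots> = (w * Re (K x x)) * Re (ip f f)" by simp
    also have "\<dots> \<le> ?T * Re (ip f f)"
      using that(3) T ip_nonneg[OF that(4)] by (intro mult_right_mono) (simp_all add: field_simps)
    finally show ?thesis .
  qed
  have "integrable \<mu> (\<lambda>x. Re (K x x) / ?T)" "(\<integral>x. Re (K x x) / ?T \<partial>\<mu>) \<le> 1"
    using trace_finite T by (simp_all add: kernel_trace_def)
  moreover have "\<forall>x\<in>space \<mu>. 0 \<le> Re (K x x) / ?T" using kernel_diagonal_nonneg T by simp
  moreover have "weighted_sum ((x, w) # S) f \<le> real (length ((x, w) # S)) * ?T * Re (ip f f)"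
    if "\<forall>f\<in>H. weighted_sum S f \<le> real (length S) * ?T * Re (ip f f)"
      and "x \<in> space \<mu>" "0 < w" "w * (Re (K x x) / ?T) \<le> 1" "f \<in> H" for S x w f
    using step[OF that(2-5)] that(1,5) by (fastforce simp: algebra_simps)
  ultimately show ?thesis
    unfolding upper_strategy_def by (intro conjI allI impI exI[of _ "\<lambda>x. Re (K x x) / ?T"]) auto
qed

text \<open>With \<open>a = sqrt (M - 1)\<close>, \<open>b = sqrt n\<close> and \<open>s = a + b\<close>, the trace stays at most \<open>a / s\<close> and the shifts
  are \<open>s / b\<close>; then \<open>1 / (s / b) + a / s = 1\<close>. The initial form is
  \<open>s\<^sup>2 * lam * \<parallel>f\<parallel>\<^sub>H\<^sup>2 - r * \<parallel>f\<parallel>\<^sub>2\<^sup>2\<close>. Here \<open>r\<close> is such that after \<open>n\<close> shifts the coefficient of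
  \<open>\<parallel>f\<parallel>\<^sub>2\<^sup>2\<close> is \<open>s / a\<close>, the reciprocal of the bound on the trace: it cancels against the excess that
  this bound provides. The hypothesis on \<open>n\<close> means \<open>r \<ge> 0\<close>, which lets \<open>\<parallel>f\<parallel>\<^sub>2\<^sup>2 \<le> lam * \<parallel>f\<parallel>\<^sub>H\<^sup>2\<close> bound
  the initial trace.\<close>

lemma upper_strategy_barrier:
  fixes lam M :: real and n :: nat
  defines "s \<equiv> sqrt (real n) + sqrt (M - 1)"
  assumes lam: "0 < lam" "\<And>f. f \<in> H \<Longrightarrow> (L2_norm \<mu> f)\<^sup>2 \<le> lam * Re (ip f f)"
    and M: "M = kernel_trace \<mu> K / lam" and n: "1 \<le> real n * (M - 1)"
  obtains Q where "upper_strategy \<mu> Q"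
    and "\<And>S f. Q S \<Longrightarrow> length S = n \<Longrightarrow> f \<in> H \<Longrightarrow> weighted_sum S f \<le> s\<^sup>2 * lam * Re (ip f f)"
proof -
  define a where "a = sqrt (M - 1)"
  define b where "b = sqrt (real n)"
  have "0 < real n * (M - 1)" using n by linarith
  then have n0: "0 < real n" and M1: "0 < M - 1" by (auto simp: zero_less_mult_iff)
  have ab: "0 < a" "0 < b" "a\<^sup>2 = M - 1" "b\<^sup>2 = real n" using n0 M1 by (auto simp: a_def b_def)
  have "1 \<le> a * b" using n by (simp add: a_def b_def real_sqrt_mult[symmetric] mult.commute)
  have "s = a + b" by (simp add: s_def a_def b_def)
  then have s: "s = a + b" "0 < s" using ab by simp_all
  define r where "r = s * (b - 1 / a)"
  have "1 / a \<le> b" using \<open>1 \<le> a * b\<close> ab by (simp add: field_simps)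
  then have r: "0 \<le> r" unfolding r_def using s(2) by (intro mult_nonneg_nonneg) auto
  have "s\<^sup>2 - r = s * (a + 1 / a)" by (simp add: r_def s(1) power2_eq_square algebra_simps)
  also have "a + 1 / a = M / a" using ab(1,3) by (simp add: field_simps power2_eq_square)
  finally have c_minus_r: "s\<^sup>2 - r = M * (s / a)" by simp
  have cr_pos: "0 < (s\<^sup>2 - r) * lam" unfolding c_minus_r using lam(1) M1 ab s by simp
  define q0 where "q0 = shift_form \<mu> (- r) (\<lambda>f g. of_real (s\<^sup>2 * lam) * ip f g)"
  have Re_q0: "Re (q0 f f) = s\<^sup>2 * lam * Re (ip f f) - r * (L2_norm \<mu> f)\<^sup>2" for f
    by (simp add: q0_def Re_shift_form del: of_real_mult of_real_power)
  have q0_ge: "((s\<^sup>2 - r) * lam) * Re (ip f f) \<le> Re (q0 f f)" if "f \<in> H" for f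
    using mult_left_mono[OF lam(2)[OF that] r] by (simp add: Re_q0 algebra_simps)
  have "bounded_form q0"
    unfolding q0_def by (rule bounded_form_shift[OF bounded_form_scale[OF bounded_form_ip]])
  then have q0: "coercive_form q0"
    using cr_pos q0_ge by (rule coercive_form_minorant[OF coercive_form_ip])
  have "form_trace q0 \<le> kernel_trace \<mu> K / ((s\<^sup>2 - r) * lam)"
    using form_trace_le[OF q0 cr_pos q0_ge] .
  also have "\<dots> = (M * lam) / (M * (s / a) * lam)" unfolding c_minus_r using M lam(1) by simp
  also have "\<dots> = a / s" using M1 lam(1) s(2) ab(1) by simp
  finally have q0_trace: "form_trace q0 \<le> a / s" .
  define Q where "Q S \<longleftrightarrow> (\<exists>q. coercive_form q \<and> form_trace q \<le> a / s \<and>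
    (\<forall>f\<in>H. Re (q f f) = s\<^sup>2 * lam * Re (ip f f) - (r - real (length S) * (s / b)) * (L2_norm \<mu> f)\<^sup>2
      - weighted_sum S f))" for S
  have "upper_strategy \<mu> Q"
    unfolding upper_strategy_def
  proof (intro conjI allI impI)
    show "Q []" unfolding Q_def using q0 q0_trace by (intro exI[of _ q0]) (simp add: Re_q0)
    fix S assume "Q S"
    then obtain q where q: "coercive_form q" "form_trace q \<le> a / s"
      "\<And>f. f \<in> H \<Longrightarrow> Re (q f f) = s\<^sup>2 * lam * Re (ip f f)
        - (r - real (length S) * (s / b)) * (L2_norm \<mu> f)\<^sup>2 - weighted_sum S f"
      unfolding Q_def by blast
    have d: "0 < s / b" using s ab by simp
    obtain U where U: "integrable \<mu> U" "(\<integral>x. U x \<partial>\<mu>) \<le> 1 / (s / b) + form_trace q"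
      "\<And>x. x \<in> space \<mu> \<Longrightarrow> 0 \<le> U x"
      "\<And>x w. \<lbrakk>x \<in> space \<mu>; 0 < w; w * U x \<le> 1\<rbrakk> \<Longrightarrow>
        coercive_form (add_evaluation (- w) x (shift_form \<mu> (s / b) q)) \<and>
        form_trace (add_evaluation (- w) x (shift_form \<mu> (s / b) q)) \<le> form_trace q"
      using upper_barrier_step[OF q(1) d] by metis
    have "1 / (s / b) + a / s = (a + b) / s" by (simp add: add_divide_distrib)
    then have "1 / (s / b) + a / s = 1" unfolding s(1)[symmetric] using s(2) by simp
    then have "(\<integral>x. U x \<partial>\<mu>) \<le> 1" using U(2) q(2) by linarith
    moreover have "Q ((x, w) # S)" if "x \<in> space \<mu>" "0 < w" "w * U x \<le> 1" for x w
      unfolding Q_def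
    proof (intro exI[of _ "add_evaluation (- w) x (shift_form \<mu> (s / b) q)"] conjI ballI)
      fix f assume "f \<in> H"
      then show "Re (add_evaluation (- w) x (shift_form \<mu> (s / b) q) f f)
        = s\<^sup>2 * lam * Re (ip f f) - (r - real (length ((x, w) # S)) * (s / b)) * (L2_norm \<mu> f)\<^sup>2
          - weighted_sum ((x, w) # S) f"
        by (simp add: Re_add_evaluation Re_shift_form q(3) algebra_simps add_divide_distrib)
    qed (use U(4)[OF that] q(2) in auto)
    ultimately show "\<exists>U. integrable \<mu> U \<and> (\<integral>x. U x \<partial>\<mu>) \<le> 1 \<and> (\<forall>x\<in>space \<mu>. 0 \<le> U x) \<and>
       (\<forall>x\<in>space \<mu>. \<forall>w>0. w * U x \<le> 1 \<longrightarrow> Q ((x, w) # S))"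
      using U(1,3) by blast
  qed
  moreover have "weighted_sum S f \<le> s\<^sup>2 * lam * Re (ip f f)" if "Q S" "length S = n" "f \<in> H" for S f
  proof -
    obtain q where q: "coercive_form q" "form_trace q \<le> a / s"
      "Re (q f f) = s\<^sup>2 * lam * Re (ip f f) - (r - real n * (s / b)) * (L2_norm \<mu> f)\<^sup>2 - weighted_sum S f"
      using \<open>Q S\<close> \<open>f \<in> H\<close> unfolding Q_def \<open>length S = n\<close> by blast
    have "(L2_norm \<mu> f)\<^sup>2 \<le> Re (q f f) * form_trace q" using q(1) that(3) by (rule L2_norm_le_form_trace)
    also have "\<dots> \<le> Re (q f f) * (a / s)"
      using q(2) coercive_form_nonneg[OF q(1) that(3)] by (rule mult_left_mono)
    finally have "(s / a) * (L2_norm \<mu> f)\<^sup>2 \<le> Re (q f f)" using s(2) ab(1) by (simp add: field_simps)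
    moreover have "r - real n * (s / b) = - (s / a)"
      using ab s(2) unfolding r_def ab(4)[symmetric] by (simp add: field_simps power2_eq_square)
    ultimately show ?thesis using q(3) by simp
  qed
  ultimately show thesis using that by blast
qed

text \<open>With \<open>a = sqrt (m - 1)\<close>, \<open>b = sqrt n\<close> and \<open>s = b - a\<close>, the trace stays at most \<open>a / s\<close> and the
  shifts are \<open>s / b\<close>; then \<open>1 / (s / b) - a / s = 1\<close>. The initial form is a multiple of the inner
  product, with trace exactly \<open>a / s\<close>.\<close>

lemma lower_strategy_barrier:
  fixes m :: real and n :: nat
  defines "s \<equiv> sqrt (real n) - sqrt (m - 1)"
  assumes ip_L2: "\<And>f. f \<in> H \<Longrightarrow> Re (ip f f) = (L2_norm \<mu> f)\<^sup>2"
    and m: "kernel_trace \<mu> K = m" "1 < m" "m \<le> real n"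
  obtains P where "lower_strategy \<mu> P"
    and "\<And>S f. P S \<Longrightarrow> length S = n \<Longrightarrow> f \<in> H \<Longrightarrow> s\<^sup>2 * (L2_norm \<mu> f)\<^sup>2 \<le> weighted_sum S f"
proof -
  define a where "a = sqrt (m - 1)"
  define b where "b = sqrt (real n)"
  have ab: "0 < a" "0 < b" "a < b" "a\<^sup>2 = m - 1" "b\<^sup>2 = real n" using m by (auto simp: a_def b_def)
  have "s = b - a" by (simp add: s_def a_def b_def)
  then have s: "s = b - a" "0 < s" using ab by simp_all
  define l where "l = m * (s / a)"
  have l: "0 < l" using m(2) s ab by (simp add: l_def)
  define p0 where "p0 = (\<lambda>f g. of_real l * ip f g)"
  have Re_p0: "Re (p0 f f) = l * Re (ip f f)" for f by (simp add: p0_def)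
  have "bounded_form p0" unfolding p0_def by (rule bounded_form_scale[OF bounded_form_ip])
  then have p0: "coercive_form p0"
    using l by (rule coercive_form_minorant[OF coercive_form_ip]) (simp add: Re_p0)
  have "form_trace p0 \<le> m / l" using form_trace_le[OF p0 l] Re_p0 m(1) by simp
  also have "\<dots> = a / s" using m(2) s ab by (simp add: l_def)
  finally have p0_trace: "form_trace p0 \<le> a / s" .
  define P where "P S \<longleftrightarrow> (\<exists>p. coercive_form p \<and> form_trace p \<le> a / s \<and>
    (\<forall>f\<in>H. Re (p f f) = (l - real (length S) * (s / b)) * (L2_norm \<mu> f)\<^sup>2 + weighted_sum S f))" for S
  have "lower_strategy \<mu> P"
    unfolding lower_strategy_def
  proof (intro conjI allI impI)
    show "P []" unfolding P_def using p0 p0_trace by (intro exI[of _ p0]) (simp add: Re_p0 ip_L2)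
    fix S assume "P S"
    then obtain p where p: "coercive_form p" "form_trace p \<le> a / s"
      "\<And>f. f \<in> H \<Longrightarrow> Re (p f f) = (l - real (length S) * (s / b)) * (L2_norm \<mu> f)\<^sup>2 + weighted_sum S f"
      unfolding P_def by blast
    have d: "0 < s / b" using s ab by simp
    have "(s / b) * form_trace p \<le> (s / b) * (a / s)" using p(2) d by (intro mult_left_mono) auto
    also have "\<dots> < 1" using s ab by simp
    finally have d1: "(s / b) * form_trace p < 1" .
    obtain L where L: "integrable \<mu> L" "1 / (s / b) - form_trace p \<le> (\<integral>x. L x \<partial>\<mu>)"
      "\<And>x w. \<lbrakk>x \<in> space \<mu>; 0 < w; 1 \<le> w * L x\<rbrakk> \<Longrightarrow>
        coercive_form (add_evaluation w x (shift_form \<mu> (- (s / b)) p)) \<and>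
        form_trace (add_evaluation w x (shift_form \<mu> (- (s / b)) p)) \<le> form_trace p"
      using lower_barrier_step[OF p(1) d d1] by metis
    have "1 / (s / b) - a / s = (b - a) / s" by (simp add: diff_divide_distrib)
    then have "1 / (s / b) - a / s = 1" unfolding s(1)[symmetric] using s(2) by simp
    then have "1 \<le> (\<integral>x. L x \<partial>\<mu>)" using L(2) p(2) by linarith
    moreover have "P ((x, w) # S)" if "x \<in> space \<mu>" "0 < w" "1 \<le> w * L x" for x w
      unfolding P_def
    proof (intro exI[of _ "add_evaluation w x (shift_form \<mu> (- (s / b)) p)"] conjI ballI)
      fix f assume "f \<in> H"
      then show "Re (add_evaluation w x (shift_form \<mu> (- (s / b)) p) f f)
        = (l - real (length ((x, w) # S)) * (s / b)) * (L2_norm \<mu> f)\<^sup>2 + weighted_sum ((x, w) # S) f"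
        by (simp add: Re_add_evaluation Re_shift_form p(3) algebra_simps add_divide_distrib)
    qed (use L(3)[OF that] p(2) in auto)
    ultimately show "\<exists>L. integrable \<mu> L \<and> 1 \<le> (\<integral>x. L x \<partial>\<mu>) \<and>
       (\<forall>x\<in>space \<mu>. \<forall>w>0. 1 \<le> w * L x \<longrightarrow> P ((x, w) # S))"
      using L(1) by blast
  qed
  moreover have "s\<^sup>2 * (L2_norm \<mu> f)\<^sup>2 \<le> weighted_sum S f" if "P S" "length S = n" "f \<in> H" for S f
  proof -
    obtain p where p: "coercive_form p" "form_trace p \<le> a / s"
      "Re (p f f) = (l - real n * (s / b)) * (L2_norm \<mu> f)\<^sup>2 + weighted_sum S f"
      using \<open>P S\<close> \<open>f \<in> H\<close> unfolding P_def \<open>length S = n\<close> by blast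
    have "(L2_norm \<mu> f)\<^sup>2 \<le> Re (p f f) * form_trace p" using p(1) that(3) by (rule L2_norm_le_form_trace)
    also have "\<dots> \<le> Re (p f f) * (a / s)"
      using p(2) coercive_form_nonneg[OF p(1) that(3)] by (rule mult_left_mono)
    finally have final: "(s / a) * (L2_norm \<mu> f)\<^sup>2 \<le> Re (p f f)" using s(2) ab(1) by (simp add: field_simps)
    have "s / a - (l - real n * (s / b)) = s\<^sup>2"
    proof -
      have "m = a\<^sup>2 + 1" using ab by simp
      then have "s / a - l = - (a * s)" using ab by (simp add: l_def field_simps power2_eq_square)
      moreover have "real n * (s / b) = b * s" using ab by (simp add: ab(5)[symmetric] power2_eq_square)
      ultimately show ?thesis by (simp add: s(1) power2_eq_square algebra_simps)
    qed
    then have "s\<^sup>2 * (L2_norm \<mu> f)\<^sup>2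
      = (s / a) * (L2_norm \<mu> f)\<^sup>2 - (l - real n * (s / b)) * (L2_norm \<mu> f)\<^sup>2"
      by (simp only: left_diff_distrib[symmetric])
    then show ?thesis using final p(3) by linarith
  qed
  ultimately show thesis using that by blast
qed

end

section \<open>Finite-dimensional subspaces of \<open>L\<^sub>2\<close>\<close>

definition expansion ::
  "'a measure \<Rightarrow> nat \<Rightarrow> (nat \<Rightarrow> 'a \<Rightarrow> complex) \<Rightarrow> ('a \<Rightarrow> complex) \<Rightarrow> 'a \<Rightarrow> complex" where
  "expansion \<mu> k b f = (\<Sum>i<k. scale_fun (l2_ip \<mu> f (b i)) (b i))"

lemma scale_fun_apply: "scale_fun c f x = c * f x"
  by (simp add: scale_fun_def)

lemma sum_fun_apply: "sum f I x = (\<Sum>i\<in>I. f i x)" for f :: "'i \<Rightarrow> 'a \<Rightarrow> complex"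
  by (induction I rule: infinite_finite_induct) auto

lemma expansion_apply: "expansion \<mu> k b f x = (\<Sum>i<k. l2_ip \<mu> f (b i) * b i x)"
  by (simp add: expansion_def sum_fun_apply scale_fun_def)

lemma l2_ip_cong_AE:
  assumes "f \<in> L2_space \<mu>" "f' \<in> L2_space \<mu>" "g \<in> L2_space \<mu>" and eq: "AE x in \<mu>. f x = f' x"
  shows "l2_ip \<mu> f g = l2_ip \<mu> f' g"
  unfolding l2_ip_def
proof (rule integral_cong_AE)
  note [measurable] = assms(1-3)[THEN L2_spaceD(1)]
  show "(\<lambda>x. f x * cnj (g x)) \<in> borel_measurable \<mu>" by measurable
  show "(\<lambda>x. f' x * cnj (g x)) \<in> borel_measurable \<mu>" by measurable
  show "AE x in \<mu>. f x * cnj (g x) = f' x * cnj (g x)" using eq by eventually_elim simp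
qed

lemma L2_norm_cong_AE:
  assumes f: "f \<in> L2_space \<mu>" and f': "f' \<in> L2_space \<mu>" and eq: "AE x in \<mu>. f x = f' x"
  shows "L2_norm \<mu> f = L2_norm \<mu> f'"
proof -
  note [measurable] = f[THEN L2_spaceD(1)] f'[THEN L2_spaceD(1)]
  have "(\<integral>x. (cmod (f x))\<^sup>2 \<partial>\<mu>) = (\<integral>x. (cmod (f' x))\<^sup>2 \<partial>\<mu>)"
  proof (rule integral_cong_AE)
    show "AE x in \<mu>. (cmod (f x))\<^sup>2 = (cmod (f' x))\<^sup>2" using eq by eventually_elim simp
  qed measurable
  then show ?thesis by (simp add: L2_norm_def)
qed

lemma L2_norm_zero: "L2_norm \<mu> 0 = 0"
  by (simp add: L2_norm_def)

lemma L2_norm_scale: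
  assumes "f \<in> L2_space \<mu>"
  shows "L2_norm \<mu> (scale_fun c f) = cmod c * L2_norm \<mu> f"
  by (simp add: L2_norm_def scale_fun_def norm_mult power_mult_distrib real_sqrt_mult)

locale L2_orthonormal =
  fixes \<mu> :: "'a measure" and k :: nat and b :: "nat \<Rightarrow> 'a \<Rightarrow> complex"
  assumes b_mem: "i < k \<Longrightarrow> b i \<in> L2_space \<mu>"
    and b_ip: "i < k \<Longrightarrow> j < k \<Longrightarrow> l2_ip \<mu> (b i) (b j) = (if i = j then 1 else 0)"
begin

lemma orthonormal_b: "l2.orthonormal \<mu> {..<k} b"
  using b_mem b_ip by (auto simp: l2.orthonormal_def)

lemma expansion_eq_projection: "expansion \<mu> k b f = l2.projection \<mu> {..<k} b f"
  by (simp add: expansion_def l2.projection_def)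

lemma expansion_mem: "expansion \<mu> k b f \<in> L2_space \<mu>"
  unfolding expansion_eq_projection by (rule l2.projection_mem[OF orthonormal_b order_refl])

lemma expansion_linear:
  shows "expansion \<mu> k b 0 x = 0"
    and "f \<in> L2_space \<mu> \<Longrightarrow> g \<in> L2_space \<mu> \<Longrightarrow>
      expansion \<mu> k b (f + g) x = expansion \<mu> k b f x + expansion \<mu> k b g x"
    and "f \<in> L2_space \<mu> \<Longrightarrow> expansion \<mu> k b (scale_fun c f) x = c * expansion \<mu> k b f x"
  using b_mem
  by (simp_all add: expansion_apply l2.zero_left l2.add_left l2.scale_left distrib_right
      sum.distrib sum_distrib_left mult.assoc cong: sum.cong_simp)

definition combination where "combination c = (\<Sum>i<k. scale_fun (c i) (b i))"

lemma combination_mem: "combination c \<in> L2_space \<mu>"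
  unfolding combination_def using b_mem
  by (intro cfun.subspace_sum[OF subspace_L2_space]) auto

lemma combination_left:
  assumes "g \<in> L2_space \<mu>"
  shows "l2_ip \<mu> (combination c) g = (\<Sum>i<k. c i * l2_ip \<mu> (b i) g)"
proof -
  have "l2_ip \<mu> (combination c) g = (\<Sum>i<k. l2_ip \<mu> (scale_fun (c i) (b i)) g)"
    unfolding combination_def using b_mem assms by (intro l2.sum_left) auto
  then show ?thesis using b_mem assms by (simp add: l2.scale_left)
qed

lemma combination_coefficient: "j < k \<Longrightarrow> l2_ip \<mu> (combination c) (b j) = c j"
proof -
  assume j: "j < k"
  have "l2_ip \<mu> (combination c) (b j) = (\<Sum>i<k. if i = j then c j else 0)"
    unfolding combination_left[OF b_mem[OF j]] using j b_ip by (intro sum.cong) auto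
  then show ?thesis using j by simp
qed

text \<open>The span of \<open>b\<close>, as the set of functions that equal their expansion at every point.\<close>

definition spanned where "spanned = {f \<in> L2_space \<mu>. expansion \<mu> k b f = f}"

lemma combination_in_spanned: "combination c \<in> spanned"
proof -
  have "expansion \<mu> k b (combination c) = combination c"
    unfolding expansion_def using combination_coefficient
    by (subst (2) combination_def) (intro sum.cong; simp)
  then show ?thesis using combination_mem by (simp add: spanned_def)
qed

lemma spannedD:
  assumes "f \<in> spanned"
  shows "f \<in> L2_space \<mu>" and "f = combination (\<lambda>i. l2_ip \<mu> f (b i))"
  using assms by (simp_all add: spanned_def expansion_def combination_def)

lemma subspace_spanned: "cfun.subspace spanned"
proof (rule cfun.subspaceI)
  have "combination (\<lambda>_. 0) = 0" by (simp add: combination_def)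
  then show "0 \<in> spanned" using combination_in_spanned by metis
  fix f g assume f: "f \<in> spanned" and g: "g \<in> spanned"
  have "f + g = combination (\<lambda>i. l2_ip \<mu> f (b i) + l2_ip \<mu> g (b i))"
    by (subst spannedD(2)[OF f], subst spannedD(2)[OF g])
      (simp only: combination_def cfun.scale_left_distrib sum.distrib)
  then show "f + g \<in> spanned" using combination_in_spanned by metis
next
  fix c f assume f: "f \<in> spanned"
  have "scale_fun c f = combination (\<lambda>i. c * l2_ip \<mu> f (b i))"
    by (subst spannedD(2)[OF f]) (simp only: combination_def cfun.scale_sum_right cfun.scale_scale)
  then show "scale_fun c f \<in> spanned" using combination_in_spanned by metis
qed

lemma L2_norm_spanned:
  assumes "f \<in> spanned"
  shows "(L2_norm \<mu> f)\<^sup>2 = (\<Sum>i<k. (cmod (l2_ip \<mu> f (b i)))\<^sup>2)"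
proof -
  have "f - l2.projection \<mu> {..<k} b f = 0"
    using assms by (simp add: spanned_def expansion_eq_projection)
  then show ?thesis
    using l2.norm_diff_projection[OF orthonormal_b _ order_refl spannedD(1)[OF assms]]
    by (simp add: Re_l2_ip_self L2_norm_zero)
qed

lemma complete_spanned:
  assumes X: "\<And>j. X j \<in> spanned"
    and Cauchy: "\<And>e. 0 < e \<Longrightarrow> \<exists>N. \<forall>i\<ge>N. \<forall>j\<ge>N. L2_norm \<mu> (X i - X j) < e"
  shows "\<exists>f\<in>spanned. (\<lambda>j. L2_norm \<mu> (X j - f)) \<longlonglongrightarrow> 0"
proof -
  have diff: "f - g \<in> spanned" if "f \<in> spanned" "g \<in> spanned" for f g
    using that subspace_spanned cfun.subspace_diff by blast
  have coefficient_le: "cmod (l2_ip \<mu> f (b i)) \<le> L2_norm \<mu> f" if "f \<in> spanned" "i < k" for f i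
  proof -
    have "(cmod (l2_ip \<mu> f (b i)))\<^sup>2 \<le> (L2_norm \<mu> f)\<^sup>2"
      unfolding L2_norm_spanned[OF that(1)] using that(2)
      by (intro member_le_sum[of i _ "\<lambda>i. (cmod (l2_ip \<mu> f (b i)))\<^sup>2"]) auto
    then show ?thesis by (rule power2_le_imp_le) simp
  qed
  have "convergent (\<lambda>j. l2_ip \<mu> (X j) (b i))" if i: "i < k" for i
  proof (rule Cauchy_convergent, rule metric_CauchyI)
    fix e :: real assume "0 < e"
    then obtain N where N: "\<forall>j\<ge>N. \<forall>l\<ge>N. L2_norm \<mu> (X j - X l) < e" using Cauchy by blast
    have "dist (l2_ip \<mu> (X j) (b i)) (l2_ip \<mu> (X l) (b i)) < e" if "j \<ge> N" "l \<ge> N" for j l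
    proof -
      have "l2_ip \<mu> (X j) (b i) - l2_ip \<mu> (X l) (b i) = l2_ip \<mu> (X j - X l) (b i)"
        using l2.diff_left[OF spannedD(1)[OF X] spannedD(1)[OF X] b_mem[OF i]] by simp
      then show ?thesis
        using coefficient_le[OF diff[OF X X] i, of j l] N that by (simp add: dist_norm) (meson le_less_trans)
    qed
    then show "\<exists>N. \<forall>j\<ge>N. \<forall>l\<ge>N. dist (l2_ip \<mu> (X j) (b i)) (l2_ip \<mu> (X l) (b i)) < e" by blast
  qed
  then obtain c where c: "\<And>i. i < k \<Longrightarrow> (\<lambda>j. l2_ip \<mu> (X j) (b i)) \<longlonglongrightarrow> c i"
    unfolding convergent_def by metis
  let ?f = "combination c"
  have "(L2_norm \<mu> (X j - ?f))\<^sup>2 = (\<Sum>i<k. (cmod (l2_ip \<mu> (X j) (b i) - c i))\<^sup>2)" for j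
    unfolding L2_norm_spanned[OF diff[OF X combination_in_spanned]]
    using l2.diff_left[OF spannedD(1)[OF X] combination_mem b_mem] combination_coefficient
    by (intro sum.cong) auto
  moreover have "(\<lambda>j. \<Sum>i<k. (cmod (l2_ip \<mu> (X j) (b i) - c i))\<^sup>2) \<longlonglongrightarrow> (\<Sum>i<k. (cmod (c i - c i))\<^sup>2)"
    using c by (intro tendsto_sum tendsto_power tendsto_norm tendsto_diff tendsto_const) auto
  ultimately have "(\<lambda>j. (L2_norm \<mu> (X j - ?f))\<^sup>2) \<longlonglongrightarrow> 0" by simp
  then have "(\<lambda>j. L2_norm \<mu> (X j - ?f)) \<longlonglongrightarrow> 0"
    using tendsto_zero_of_square_le[of "\<lambda>j. L2_norm \<mu> (X j - ?f)", OF order_refl] by blast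
  then show ?thesis using combination_in_spanned by blast
qed

definition kern where "kern x = combination (\<lambda>i. cnj (b i x))"

lemma reproducing_kern:
  assumes f: "f \<in> spanned"
  shows "l2_ip \<mu> f (kern x) = f x"
proof -
  note f' = spannedD(1)[OF f]
  have "cnj (cnj (b i x) * l2_ip \<mu> (b i) f) = l2_ip \<mu> f (b i) * b i x" if "i < k" for i
    using l2.herm[OF f' b_mem[OF that]] by simp
  then have "cnj (l2_ip \<mu> (kern x) f) = (\<Sum>i<k. l2_ip \<mu> f (b i) * b i x)"
    unfolding kern_def combination_left[OF f'] cnj_sum by (intro sum.cong) auto
  also have "\<dots> = f x" using f by (simp add: spanned_def flip: expansion_apply)
  finally show ?thesis using l2.herm[of "kern x" \<mu> f] f' combination_mem by (simp add: kern_def)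
qed

lemma kern_diagonal: "Re (kern x x) = (\<Sum>i<k. (cmod (b i x))\<^sup>2)"
proof -
  have "kern x x = (\<Sum>i<k. of_real ((cmod (b i x))\<^sup>2))"
    unfolding complex_norm_square by (simp add: kern_def combination_def sum_fun_apply scale_fun_def mult.commute)
  then show ?thesis by (simp only: of_real_sum[symmetric] Re_complex_of_real)
qed

lemma L2_norm_b: "i < k \<Longrightarrow> (L2_norm \<mu> (b i))\<^sup>2 = 1"
  using b_ip[of i i] Re_l2_ip_self[of \<mu> "b i"] by simp

lemma integrable_kern: "integrable \<mu> (\<lambda>x. Re (kern x x))"
  unfolding kern_diagonal using b_mem L2_spaceD(2) by (intro Bochner_Integration.integrable_sum) auto

lemma kernel_trace_kern: "kernel_trace \<mu> kern = real k"
proof -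
  have "kernel_trace \<mu> kern = (\<Sum>i<k. \<integral>x. (cmod (b i x))\<^sup>2 \<partial>\<mu>)"
    unfolding kernel_trace_def kern_diagonal using b_mem L2_spaceD(2)
    by (intro Bochner_Integration.integral_sum) auto
  also have "\<dots> = (\<Sum>i<k. 1)" using L2_norm_b L2_norm_square[of \<mu>] by (intro sum.cong) auto
  finally show ?thesis by simp
qed

lemma ip_norm_l2: "ip_norm (l2_ip \<mu>) f = L2_norm \<mu> f"
  by (simp add: ip_norm_def Re_l2_ip_self)

lemma L2_norm_pos:
  assumes "f \<in> spanned" and "f \<noteq> 0"
  shows "0 < L2_norm \<mu> f"
proof (rule ccontr)
  assume "\<not> 0 < L2_norm \<mu> f"
  then have "L2_norm \<mu> f = 0" using L2_norm_nonneg[of \<mu> f] by linarith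
  then have "(\<Sum>i<k. (cmod (l2_ip \<mu> f (b i)))\<^sup>2) = 0" using L2_norm_spanned[OF assms(1)] by simp
  then have "\<forall>i<k. l2_ip \<mu> f (b i) = 0" by (simp add: sum_nonneg_eq_0_iff)
  then have "f = 0" using spannedD(2)[OF assms(1)] by (simp add: combination_def)
  then show False using assms(2) by simp
qed

lemma L2_rkhs_spanned:
  assumes "0 < k"
  shows "L2_rkhs \<mu> spanned (l2_ip \<mu>) kern"
proof
  show "spanned \<subseteq> functions_on (space \<mu>)"
    using spannedD(1) by (auto simp: L2_space_def)
  show "cfun.subspace spanned" by (rule subspace_spanned)
  show "l2_ip \<mu> (f + g) h = l2_ip \<mu> f h + l2_ip \<mu> g h" if "f \<in> spanned" "g \<in> spanned" "h \<in> spanned" for f g h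
    using that spannedD(1) l2.add_left by blast
  show "l2_ip \<mu> (scale_fun c f) g = c * l2_ip \<mu> f g" if "f \<in> spanned" "g \<in> spanned" for c f g
    using that spannedD(1) l2.scale_left by blast
  show "l2_ip \<mu> g f = cnj (l2_ip \<mu> f g)" if "f \<in> spanned" "g \<in> spanned" for f g
    using that spannedD(1) l2.herm by blast
  show "0 < Re (l2_ip \<mu> f f)" if "f \<in> spanned" "f \<noteq> 0" for f
    using L2_norm_pos[OF that] by (simp add: Re_l2_ip_self)
  show "\<exists>f\<in>spanned. (\<lambda>k. ip_norm (l2_ip \<mu>) (X k - f)) \<longlonglongrightarrow> 0"
    if "\<And>k. X k \<in> spanned"
      "\<And>e. 0 < e \<Longrightarrow> \<exists>N. \<forall>j\<ge>N. \<forall>k\<ge>N. ip_norm (l2_ip \<mu>) (X j - X k) < e" for X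
    using complete_spanned[of X] that unfolding ip_norm_l2 by blast
  show "\<exists>d>0. \<forall>g\<in>spanned. ip_norm (l2_ip \<mu>) (g - f) < d \<longrightarrow> cmod (g x - f x) < e"
    if "f \<in> spanned" "0 < e" for x f e
  proof (intro exI[of _ "e / (L2_norm \<mu> (kern x) + 1)"] conjI ballI impI)
    have pos: "0 < L2_norm \<mu> (kern x) + 1" using L2_norm_nonneg[of \<mu> "kern x"] by linarith
    then show "0 < e / (L2_norm \<mu> (kern x) + 1)" using that by simp
    fix g assume g: "g \<in> spanned"
      and less: "ip_norm (l2_ip \<mu>) (g - f) < e / (L2_norm \<mu> (kern x) + 1)"
    have gf: "g - f \<in> spanned" using g that(1) subspace_spanned cfun.subspace_diff by blast
    have "(cmod ((g - f) x))\<^sup>2 \<le> (L2_norm \<mu> (g - f))\<^sup>2 * (L2_norm \<mu> (kern x))\<^sup>2"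
      using l2.Cauchy_Schwarz[of \<mu> "g - f" "kern x"] gf spannedD(1) combination_mem reproducing_kern[OF gf]
      by (simp add: Re_l2_ip_self kern_def)
    then have "cmod ((g - f) x) \<le> L2_norm \<mu> (g - f) * L2_norm \<mu> (kern x)"
      unfolding power_mult_distrib[symmetric] by (rule power2_le_imp_le) simp
    also have "\<dots> \<le> L2_norm \<mu> (g - f) * (L2_norm \<mu> (kern x) + 1)"
      by (intro mult_left_mono) auto
    also have "\<dots> < e" using less pos unfolding ip_norm_l2 by (simp add: pos_less_divide_eq)
    finally show "cmod (g x - f x) < e" by simp
  qed
  show "kern x \<in> spanned" for x unfolding kern_def by (rule combination_in_spanned)
  show "l2_ip \<mu> f (kern x) = f x" if "f \<in> spanned" for x f using reproducing_kern[OF that] .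
  show "spanned \<subseteq> L2_space \<mu>" using spannedD(1) by blast
  show "L2_norm \<mu> f \<noteq> 0" if "f \<in> spanned" "f \<noteq> 0" for f using L2_norm_pos[OF that] by simp
  show "integrable \<mu> (\<lambda>x. Re (kern x x))" by (rule integrable_kern)
  show "spanned \<noteq> {0}"
  proof
    assume "spanned = {0}"
    then have "combination (\<lambda>_. 1) = 0" using combination_in_spanned by blast
    then show False
      using combination_coefficient[OF assms, of "\<lambda>_. 1"] l2.zero_left[OF b_mem[OF assms]] by simp
  qed
qed

end

text \<open>The Gram-Schmidt process: the part \<open>h\<close> of a new function orthogonal to the previous ones is either
  normalized and appended, or has norm zero, and then the set where it does not vanish is added to
  the exceptional null set.\<close>

lemma orthonormal_expansion_off_null_set:
  fixes B :: "('a \<Rightarrow> complex) set"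
  assumes "finite B" and "B \<subseteq> L2_space \<mu>"
  shows "\<exists>k b Z. k \<le> card B \<and> L2_orthonormal \<mu> k b \<and> Z \<in> null_sets \<mu> \<and>
    (\<forall>f\<in>cfun.span B. f \<in> L2_space \<mu> \<and> (\<forall>x\<in>space \<mu> - Z. f x = expansion \<mu> k b f x))"
  using assms
proof (induction B rule: finite_induct)
  case empty
  show ?case
  proof (intro exI conjI ballI)
    show "0 \<le> card ({} :: ('a \<Rightarrow> complex) set)" by simp
    show "L2_orthonormal \<mu> 0 undefined" by standard auto
    show "{} \<in> null_sets \<mu>" by simp
    fix f :: "'a \<Rightarrow> complex" assume "f \<in> cfun.span {}"
    then have f: "f = 0" by (simp only: cfun.span_empty singleton_iff)
    show "f \<in> L2_space \<mu>" unfolding f by (rule l2.mem(4))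
    show "f x = expansion \<mu> 0 undefined f x" for x by (simp add: f expansion_apply)
  qed
next
  case (insert g B)
  then obtain k b Z where k: "k \<le> card B" and b: "L2_orthonormal \<mu> k b" and Z: "Z \<in> null_sets \<mu>"
    and B: "\<And>f. f \<in> cfun.span B \<Longrightarrow> f \<in> L2_space \<mu> \<and> (\<forall>x\<in>space \<mu> - Z. f x = expansion \<mu> k b f x)"
    by (metis insert_subset)
  interpret b: L2_orthonormal \<mu> k b by (rule b)
  have g: "g \<in> L2_space \<mu>" using insert.prems by simp
  have extend: ?case
    if k': "k' \<le> Suc k" and b': "L2_orthonormal \<mu> k' b'" and Z': "Z' \<in> null_sets \<mu>"
      and eq: "\<And>f x. f \<in> insert g B \<Longrightarrow> x \<in> space \<mu> - Z' \<Longrightarrow> f x = expansion \<mu> k' b' f x"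
    for k' b' Z'
  proof -
    interpret b': L2_orthonormal \<mu> k' b' by (rule b')
    let ?W = "{f \<in> L2_space \<mu>. \<forall>x\<in>space \<mu> - Z'. f x = expansion \<mu> k' b' f x}"
    have "cfun.subspace ?W"
    proof (rule cfun.subspaceI)
      show "0 \<in> ?W" using l2.mem(4) b'.expansion_linear(1) by simp
      fix f h assume "f \<in> ?W" "h \<in> ?W"
      then show "f + h \<in> ?W"
        using b'.expansion_linear(2) by auto
    next
      fix c f assume "f \<in> ?W"
      then show "scale_fun c f \<in> ?W"
        using b'.expansion_linear(3) by (auto simp: scale_fun_apply)
    qed
    moreover have "insert g B \<subseteq> ?W" using insert.prems eq by auto
    ultimately have "cfun.span (insert g B) \<subseteq> ?W" by (rule cfun.span_minimal[rotated])
    moreover have "k' \<le> card (insert g B)" using k k' insert.hyps by simp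
    ultimately show ?case using b' Z' by (intro exI[of _ k'] exI[of _ b'] exI[of _ Z']) auto
  qed
  define h where "h = g - expansion \<mu> k b g"
  have h: "h \<in> L2_space \<mu>" unfolding h_def using g b.expansion_mem by simp
  have h_orth: "l2_ip \<mu> h (b i) = 0" if "i < k" for i
    unfolding h_def l2.diff_left[OF g b.expansion_mem b.b_mem[OF that]]
    unfolding b.expansion_eq_projection
    using l2.projection_coefficient[OF b.orthonormal_b finite_lessThan order_refl _ g, of i] that by simp
  have orth_h: "l2_ip \<mu> (b i) h = 0" if "i < k" for i
    using l2.herm[OF h b.b_mem[OF that]] h_orth[OF that] by simp
  have expansion_orth: "l2_ip \<mu> (expansion \<mu> k b f) h = 0" for f
    unfolding b.expansion_eq_projection
    unfolding l2.projection_left[OF b.orthonormal_b finite_lessThan order_refl h]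
    using orth_h by simp
  show ?case
  proof (cases "L2_norm \<mu> h = 0")
    case True
    have "AE x in \<mu>. (cmod (h x))\<^sup>2 = 0"
      using integral_nonneg_eq_0_iff_AE[OF L2_spaceD(2)[OF h]] True L2_norm_square[of \<mu> h] by simp
    then obtain N where N: "{x \<in> space \<mu>. \<not> (cmod (h x))\<^sup>2 = 0} \<subseteq> N" "N \<in> null_sets \<mu>"
      unfolding eventually_ae_filter by blast
    show ?thesis
    proof (rule extend)
      show "k \<le> Suc k" by simp
      show "L2_orthonormal \<mu> k b" by (rule b)
      show "Z \<union> N \<in> null_sets \<mu>" using Z N(2) by blast
      show "f x = expansion \<mu> k b f x" if "f \<in> insert g B" "x \<in> space \<mu> - (Z \<union> N)" for f x
      proof (cases "f = g")
        case True
        then have "h x = 0" using that(2) N(1) by auto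
        then show ?thesis using True by (simp add: h_def)
      next
        case False
        then show ?thesis using that B cfun.span_base by auto
      qed
    qed
  next
    case False
    define u where "u = scale_fun (of_real (1 / L2_norm \<mu> h)) h"
    have u: "u \<in> L2_space \<mu>" unfolding u_def using h by simp
    define b' where "b' = b(k := u)"
    have b'_simps: "b' k = u" "\<And>i. i < k \<Longrightarrow> b' i = b i" by (auto simp: b'_def)
    have hh: "l2_ip \<mu> h h = of_real (L2_norm \<mu> h) * of_real (L2_norm \<mu> h)"
      by (simp add: l2_ip_self power2_eq_square)
    have uu: "l2_ip \<mu> u u = 1"
      using h False by (simp add: u_def l2.scale_left l2.scale_right hh)
    have b'_eq: "expansion \<mu> (Suc k) b' f x = expansion \<mu> k b f x + l2_ip \<mu> f u * u x" for f x
      by (simp add: expansion_apply b'_simps)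
    show ?thesis
    proof (rule extend)
      show "Suc k \<le> Suc k" by simp
      show "Z \<in> null_sets \<mu>" by (rule Z)
      show "L2_orthonormal \<mu> (Suc k) b'"
      proof
        show "b' i \<in> L2_space \<mu>" if "i < Suc k" for i
          using that u b.b_mem by (auto simp: b'_def)
        have ub: "l2_ip \<mu> u (b i) = 0" "l2_ip \<mu> (b i) u = 0" if "i < k" for i
          using h b.b_mem[OF that] h_orth[OF that] orth_h[OF that]
          by (simp_all add: u_def l2.scale_left l2.scale_right)
        show "l2_ip \<mu> (b' i) (b' j) = (if i = j then 1 else 0)" if "i < Suc k" "j < Suc k" for i j
          using that ub uu b.b_ip by (auto simp: less_Suc_eq b'_simps)
      qed
      show "f x = expansion \<mu> (Suc k) b' f x" if f: "f \<in> insert g B" and x: "x \<in> space \<mu> - Z" for f x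
      proof (cases "f = g")
        case True
        have "l2_ip \<mu> g h = l2_ip \<mu> h h"
          using l2.diff_left[OF g b.expansion_mem[of g] h] expansion_orth[of g] by (simp add: h_def)
        then have "l2_ip \<mu> g u * u x = h x"
          using False g h by (simp add: u_def l2.scale_right hh scale_fun_apply)
        then show ?thesis using True by (simp add: b'_eq h_def)
      next
        case False
        then have fB: "f \<in> L2_space \<mu>" "\<forall>x\<in>space \<mu> - Z. f x = expansion \<mu> k b f x"
          using f B cfun.span_base by auto
        have "AE x in \<mu>. f x = expansion \<mu> k b f x"
          using AE_not_in[OF Z] AE_space by eventually_elim (use fB(2) in auto)
        then have "l2_ip \<mu> f h = 0"
          using l2_ip_cong_AE[OF fB(1) b.expansion_mem h] expansion_orth by simp
        then have "l2_ip \<mu> f u = 0" using fB(1) h by (simp add: u_def l2.scale_right)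
        then show ?thesis using fB(2) x by (simp add: b'_eq)
      qed
    qed
  qed
qed

lemma weighted_sum_zero: "weighted_sum S (\<lambda>_. 0) = 0"
  by (induction S) auto

text \<open>Points off the exceptional null set do not distinguish \<open>f\<close> from its expansion, so the barrier on the
  span of the orthonormal functions suffices. If all functions in the span of \<open>B\<close> vanish almost
  everywhere, the bound is trivial, but a strategy still has to provide some \<open>L\<close> with integral at
  least \<open>1\<close>; then \<open>h\<close> yields one.\<close>

lemma lower_strategy_finite_span:
  fixes n m :: nat
  assumes B: "finite B" "B \<subseteq> L2_space \<mu>" "card B \<le> m" and n: "1 \<le> m" "m \<le> n"
    and h: "h \<in> L2_space \<mu>" "L2_norm \<mu> h \<noteq> 0"
  obtains P Z where "lower_strategy \<mu> P" and "Z \<in> null_sets \<mu>"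
    and "\<And>S f. \<lbrakk>P S; length S = n; \<forall>(x, w)\<in>set S. x \<in> space \<mu> - Z; f \<in> cfun.span B\<rbrakk> \<Longrightarrow>
      (sqrt (real n) - sqrt (real m - 1))\<^sup>2 * (L2_norm \<mu> f)\<^sup>2 \<le> weighted_sum S f"
proof -
  obtain k b Z where k: "k \<le> card B" and b: "L2_orthonormal \<mu> k b" and Z: "Z \<in> null_sets \<mu>"
    and span: "\<And>f. f \<in> cfun.span B \<Longrightarrow> f \<in> L2_space \<mu> \<and> (\<forall>x\<in>space \<mu> - Z. f x = expansion \<mu> k b f x)"
    using orthonormal_expansion_off_null_set[OF B(1,2)] by blast
  interpret b: L2_orthonormal \<mu> k b by (rule b)
  have norm_eq: "L2_norm \<mu> f = L2_norm \<mu> (expansion \<mu> k b f)" if "f \<in> cfun.span B" for f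
  proof (rule L2_norm_cong_AE)
    show "AE x in \<mu>. f x = expansion \<mu> k b f x"
      using AE_not_in[OF Z] AE_space by eventually_elim (use span[OF that] in auto)
  qed (use span[OF that] b.expansion_mem in auto)
  have sum_eq: "weighted_sum S f = weighted_sum S (expansion \<mu> k b f)"
    if "\<forall>(x, w)\<in>set S. x \<in> space \<mu> - Z" "f \<in> cfun.span B" for S f
    unfolding weighted_sum_def using that(1) span[OF that(2)]
    by (intro arg_cong[where f = sum_list] map_cong) auto
  have expansion_spanned: "expansion \<mu> k b f \<in> b.spanned" for f
    using b.combination_in_spanned by (metis b.combination_def expansion_def)
  have le_n: "(sqrt (real n) - sqrt (real m - 1))\<^sup>2 \<le> real n"
  proof -
    have "(sqrt (real n) - sqrt (real m - 1))\<^sup>2 \<le> (sqrt (real n))\<^sup>2"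
      using n by (intro power_mono) auto
    then show ?thesis by simp
  qed
  consider "k = 0" | "k = 1" | "2 \<le> k" by linarith
  then show thesis
  proof cases
    case 1
    define u where "u = scale_fun (of_real (1 / L2_norm \<mu> h)) h"
    have "u \<in> L2_space \<mu>" unfolding u_def using h(1) by simp
    moreover have "L2_norm \<mu> u = 1"
      unfolding u_def L2_norm_scale[OF h(1)] using h(2) by (simp add: norm_divide)
    ultimately have "lower_strategy \<mu> (\<lambda>S. real (length S) \<le> weighted_sum S u)"
      by (rule lower_strategy_linear)
    moreover have "(sqrt (real n) - sqrt (real m - 1))\<^sup>2 * (L2_norm \<mu> f)\<^sup>2 \<le> weighted_sum S f"
      if "\<forall>(x, w)\<in>set S. x \<in> space \<mu> - Z" "f \<in> cfun.span B" for S f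
    proof -
      have "expansion \<mu> k b f = (\<lambda>_. 0)" using 1 by (simp add: fun_eq_iff expansion_apply)
      then show ?thesis
        unfolding norm_eq[OF that(2)] sum_eq[OF that] by (simp add: L2_norm_def weighted_sum_zero)
    qed
    ultimately show thesis using that Z by blast
  next
    case 2
    then have b0: "b 0 \<in> L2_space \<mu>" "L2_norm \<mu> (b 0) = 1"
      using b.b_mem[of 0] b.L2_norm_b[of 0] L2_norm_nonneg[of \<mu> "b 0"] by (auto simp: power2_eq_1_iff)
    have "(sqrt (real n) - sqrt (real m - 1))\<^sup>2 * (L2_norm \<mu> f)\<^sup>2 \<le> weighted_sum S f"
      if "real (length S) \<le> weighted_sum S (b 0)" "length S = n"
        "\<forall>(x, w)\<in>set S. x \<in> space \<mu> - Z" "f \<in> cfun.span B" for S f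
    proof -
      let ?c = "l2_ip \<mu> f (b 0)"
      have e: "expansion \<mu> k b f = scale_fun ?c (b 0)" using 2 by (simp add: expansion_def)
      have "weighted_sum S (scale_fun ?c (b 0)) = (cmod ?c)\<^sup>2 * weighted_sum S (b 0)"
        unfolding weighted_sum_def
        by (induction S) (auto simp: scale_fun_def norm_mult power_mult_distrib algebra_simps)
      moreover have "(L2_norm \<mu> (scale_fun ?c (b 0)))\<^sup>2 = (cmod ?c)\<^sup>2"
        unfolding L2_norm_scale[OF b0(1)] b0(2) by simp
      moreover have "(sqrt (real n) - sqrt (real m - 1))\<^sup>2 * (cmod ?c)\<^sup>2 \<le> weighted_sum S (b 0) * (cmod ?c)\<^sup>2"
        using le_n that(1,2) by (intro mult_right_mono) auto
      ultimately show ?thesis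
        unfolding norm_eq[OF that(4)] sum_eq[OF that(3,4)] e by (simp add: mult.commute)
    qed
    then show thesis using that lower_strategy_linear[OF b0] Z by blast
  next
    case 3
    interpret L2_rkhs \<mu> b.spanned "l2_ip \<mu>" b.kern using 3 by (intro b.L2_rkhs_spanned) simp
    have "1 < real k" "real k \<le> real n" "real k \<le> real m" using 3 k B(3) n by auto
    obtain P where P: "lower_strategy \<mu> P"
      "\<And>S f. P S \<Longrightarrow> length S = n \<Longrightarrow> f \<in> b.spanned \<Longrightarrow>
        (sqrt (real n) - sqrt (real k - 1))\<^sup>2 * (L2_norm \<mu> f)\<^sup>2 \<le> weighted_sum S f"
      using lower_strategy_barrier[OF Re_l2_ip_self b.kernel_trace_kern \<open>1 < real k\<close> \<open>real k \<le> real n\<close>]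
      by metis
    have "sqrt (real k - 1) \<le> sqrt (real m - 1)" "sqrt (real m - 1) \<le> sqrt (real n)"
      using \<open>real k \<le> real m\<close> n by auto
    then have mono: "(sqrt (real n) - sqrt (real m - 1))\<^sup>2 \<le> (sqrt (real n) - sqrt (real k - 1))\<^sup>2"
      by (intro power_mono) auto
    have "(sqrt (real n) - sqrt (real m - 1))\<^sup>2 * (L2_norm \<mu> f)\<^sup>2 \<le> weighted_sum S f"
      if "P S" "length S = n" "\<forall>(x, w)\<in>set S. x \<in> space \<mu> - Z" "f \<in> cfun.span B" for S f
      using P(2)[OF that(1,2) expansion_spanned[of f]]
        mult_right_mono[OF mono, of "(L2_norm \<mu> (expansion \<mu> k b f))\<^sup>2"]
      unfolding norm_eq[OF that(4)] sum_eq[OF that(3,4)] by simp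
    then show thesis using that P(1) Z by blast
  qed
qed

section \<open>Both bounds together\<close>

lemma (in L2_rkhs) upper_strategy:
  fixes n :: nat and lam M :: real
  assumes lam: "0 < lam" "lam \<le> kernel_trace \<mu> K"
      "\<And>f. f \<in> H \<Longrightarrow> (L2_norm \<mu> f)\<^sup>2 \<le> lam * Re (ip f f)"
    and M: "M = kernel_trace \<mu> K / lam"
  obtains Q where "upper_strategy \<mu> Q"
    and "\<And>S f. Q S \<Longrightarrow> length S = n \<Longrightarrow> f \<in> H \<Longrightarrow>
      weighted_sum S f \<le> (sqrt (real n) + sqrt (M - 1))\<^sup>2 * lam * Re (ip f f)"
proof (cases "1 \<le> real n * (M - 1)")
  case True
  then show thesis using upper_strategy_barrier[OF lam(1,3) M True] that by blast
next
  case False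
  have T: "kernel_trace \<mu> K = M * lam" using M lam(1) by simp
  have M1: "1 \<le> M" using M lam(1,2) by simp
  \<comment> \<open>The linear strategy gives the factor \<open>n * M = n + t\<^sup>2\<close>, and \<open>t\<^sup>2 \<le> 2 * t\<close> as \<open>t \<le> 1\<close>.\<close>
  define t where "t = sqrt (real n) * sqrt (M - 1)"
  have t: "0 \<le> t" "t\<^sup>2 = real n * (M - 1)" using M1 by (simp_all add: t_def power_mult_distrib)
  then have "t \<le> 1" using False power2_le_imp_le[of t 1] by simp
  then have "t\<^sup>2 \<le> 2 * t" using t(1) mult_left_mono[of t 2 t] by (simp add: power2_eq_square)
  then have "real n * M \<le> real n + 2 * t + (M - 1)" using t(2) M1 by (simp add: algebra_simps)
  also have "\<dots> = (sqrt (real n) + sqrt (M - 1))\<^sup>2" using M1 by (simp add: power2_sum t_def)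
  finally have le: "real n * M \<le> (sqrt (real n) + sqrt (M - 1))\<^sup>2" .
  have "weighted_sum S f \<le> (sqrt (real n) + sqrt (M - 1))\<^sup>2 * lam * Re (ip f f)"
    if "\<forall>f\<in>H. weighted_sum S f \<le> real (length S) * kernel_trace \<mu> K * Re (ip f f)"
      "length S = n" "f \<in> H" for S f
  proof -
    have "weighted_sum S f \<le> (real n * M) * (lam * Re (ip f f))"
      using that T by (fastforce simp: mult.assoc)
    also have "\<dots> \<le> (sqrt (real n) + sqrt (M - 1))\<^sup>2 * (lam * Re (ip f f))"
      using le lam(1) ip_nonneg[OF that(3)] by (intro mult_right_mono) auto
    finally show ?thesis by (simp add: mult.assoc)
  qed
  then show thesis using that upper_strategy_linear by blast
qed

lemma sum_nth_eq_weighted_sum: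
  assumes "length S = n"
  shows "(\<Sum>i=1..n. snd (S ! (i - 1)) / c * (cmod (f (fst (S ! (i - 1)))))\<^sup>2) = weighted_sum S f / c"
proof -
  have "(\<Sum>i=1..n. snd (S ! (i - 1)) / c * (cmod (f (fst (S ! (i - 1)))))\<^sup>2)
    = (\<Sum>i<n. snd (S ! i) * (cmod (f (fst (S ! i))))\<^sup>2 / c)"
    by (simp add: sum.atLeast1_atMost_eq)
  also have "\<dots> = weighted_sum S f / c"
    using assms unfolding weighted_sum_def sum_list_sum_nth sum_divide_distrib
    by (simp add: case_prod_beta atLeast0LessThan)
  finally show ?thesis .
qed

theorem corollary6:
  fixes \<mu> :: "'a measure"
    and V H :: "('a \<Rightarrow> complex) set"
    and ip :: "('a \<Rightarrow> complex) \<Rightarrow> ('a \<Rightarrow> complex) \<Rightarrow> complex"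
    and K :: "'a \<Rightarrow> 'a \<Rightarrow> complex"
    and lam M :: real
    and m n :: nat
  assumes "1 \<le> m"
    and "V \<subseteq> L2_space \<mu>" and "cfun.subspace V" and "cfun.dim V = m"
    and "rkhs_with_kernel (space \<mu>) H ip K"
    and "H \<noteq> {0}" and "H \<subseteq> L2_space \<mu>"
    and "bdd_above ((\<lambda>f. (L2_norm \<mu> f)\<^sup>2 / (ip_norm ip f)\<^sup>2) ` (H - {0}))"
    and "lam = (SUP f\<in>H - {0}. (L2_norm \<mu> f)\<^sup>2 / (ip_norm ip f)\<^sup>2)"
    and "\<forall>f\<in>H - {0}. L2_norm \<mu> f \<noteq> 0"
    and "integrable \<mu> (\<lambda>x. Re (K x x))"
    and "M = kernel_trace \<mu> K / lam"
    and "m \<le> n"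
  shows "\<exists>(x :: nat \<Rightarrow> 'a) (w :: nat \<Rightarrow> real).
    (\<forall>i\<in>{1..n}. x i \<in> space \<mu> \<and> 0 < w i) \<and>
    (\<forall>f\<in>V. (1 - sqrt ((real m - 1) / real n)) * L2_norm \<mu> f
        \<le> sqrt (\<Sum>i=1..n. w i * (cmod (f (x i)))\<^sup>2)) \<and>
    (\<forall>g\<in>H. sqrt (\<Sum>i=1..n. w i * (cmod (g (x i)))\<^sup>2)
        \<le> (1 + sqrt ((M - 1) / real n)) * sqrt lam * ip_norm ip g)"
proof -
  interpret rkhs_with_kernel "space \<mu>" H ip K by fact
  interpret L2_rkhs \<mu> H ip K by standard (use assms in auto)
  have n: "0 < real n" using assms(1,13) by simp
  obtain h where h: "h \<in> H" "h \<noteq> 0" using nontrivial ip.mem(4) by blast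
  have ratio_le: "(L2_norm \<mu> f)\<^sup>2 / (ip_norm ip f)\<^sup>2 \<le> lam" if "f \<in> H - {0}" for f
    unfolding assms(9) using assms(8) that by (rule cSUP_upper[rotated])
  have L2_le: "(L2_norm \<mu> f)\<^sup>2 \<le> lam * Re (ip f f)" if f: "f \<in> H" for f
  proof (cases "f = 0")
    case True
    then show ?thesis using ip.zero_left[OF f] by (simp add: L2_norm_def)
  next
    case False
    then show ?thesis
      using ratio_le[of f] f ip_pos[OF f False] by (simp add: ip_norm_square pos_divide_le_eq)
  qed
  have lam_pos: "0 < lam"
  proof -
    have "0 < (L2_norm \<mu> h)\<^sup>2 / (ip_norm ip h)\<^sup>2"
      using L2_definite[OF h] ip_pos[OF h] ip_norm_square[OF h(1)] by simp
    then show ?thesis using ratio_le[of h] h by simp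
  qed
  have lam_le: "lam \<le> kernel_trace \<mu> K"
    unfolding assms(9)
  proof (rule cSUP_least)
    show "H - {0} \<noteq> {}" using h by blast
    fix f assume "f \<in> H - {0}"
    then show "(L2_norm \<mu> f)\<^sup>2 / (ip_norm ip f)\<^sup>2 \<le> kernel_trace \<mu> K"
      using L2_norm_le_trace[of f] ip_pos[of f] by (simp add: ip_norm_square pos_divide_le_eq)
  qed
  have M1: "1 \<le> M" using lam_pos lam_le assms(12) by simp
  obtain B where B: "B \<subseteq> V" "cfun.independent B" "V \<subseteq> cfun.span B" "card B = m"
    using cfun.basis_exists[of V] assms(4) by metis
  have finB: "finite B" using B(4) assms(1) by (metis card.infinite not_one_le_zero)
  have hL2: "h \<in> L2_space \<mu>" "L2_norm \<mu> h \<noteq> 0" using h in_L2 L2_definite by auto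
  have BL2: "B \<subseteq> L2_space \<mu>" using B(1) assms(2) by blast
  obtain P Z where P: "lower_strategy \<mu> P" "Z \<in> null_sets \<mu>"
    "\<And>S f. \<lbrakk>P S; length S = n; \<forall>(x, w)\<in>set S. x \<in> space \<mu> - Z; f \<in> cfun.span B\<rbrakk> \<Longrightarrow>
      (sqrt (real n) - sqrt (real m - 1))\<^sup>2 * (L2_norm \<mu> f)\<^sup>2 \<le> weighted_sum S f"
    using lower_strategy_finite_span[OF finB BL2 eq_refl[OF B(4)] assms(1,13) hL2] by metis
  obtain Q where Q: "upper_strategy \<mu> Q"
    "\<And>S f. Q S \<Longrightarrow> length S = n \<Longrightarrow> f \<in> H \<Longrightarrow>
      weighted_sum S f \<le> (sqrt (real n) + sqrt (M - 1))\<^sup>2 * lam * Re (ip f f)"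
    using upper_strategy[OF lam_pos lam_le L2_le assms(12), of n] by metis
  obtain S where S: "length S = n" "P S" "Q S" "\<forall>(x, w)\<in>set S. x \<in> space \<mu> - Z \<and> 0 < w"
    using strategies_combine[OF P(1) Q(1) P(2)] by blast
  define x where "x i = fst (S ! (i - 1))" for i
  define w where "w i = snd (S ! (i - 1)) / real n" for i
  have sum_eq: "(\<Sum>i=1..n. w i * (cmod (f (x i)))\<^sup>2) = weighted_sum S f / real n" for f
    unfolding x_def w_def using S(1) by (rule sum_nth_eq_weighted_sum)
  have points: "x i \<in> space \<mu> \<and> 0 < w i" if "i \<in> {1..n}" for i
  proof -
    have "S ! (i - 1) \<in> set S" using that S(1) by (intro nth_mem) auto
    then show ?thesis using S(4) n by (auto simp: x_def w_def case_prod_beta)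
  qed
  have lower: "(1 - sqrt ((real m - 1) / real n)) * L2_norm \<mu> f \<le> sqrt (\<Sum>i=1..n. w i * (cmod (f (x i)))\<^sup>2)"
    if "f \<in> V" for f
  proof -
    have "1 - sqrt ((real m - 1) / real n) = (sqrt (real n) - sqrt (real m - 1)) / sqrt (real n)"
      unfolding real_sqrt_divide using n by (simp add: diff_divide_distrib)
    then have "((1 - sqrt ((real m - 1) / real n)) * L2_norm \<mu> f)\<^sup>2
      = (sqrt (real n) - sqrt (real m - 1))\<^sup>2 * (L2_norm \<mu> f)\<^sup>2 / real n"
      by (simp add: power_mult_distrib power_divide)
    also have "\<dots> \<le> weighted_sum S f / real n"
      using P(3)[OF S(2,1) _ subsetD[OF B(3) that]] S(4) n by (intro divide_right_mono) auto
    finally show ?thesis unfolding sum_eq by (rule real_le_rsqrt)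
  qed
  have upper: "sqrt (\<Sum>i=1..n. w i * (cmod (g (x i)))\<^sup>2) \<le> (1 + sqrt ((M - 1) / real n)) * sqrt lam * ip_norm ip g"
    if g: "g \<in> H" for g
  proof (rule real_le_lsqrt)
    show "0 \<le> (1 + sqrt ((M - 1) / real n)) * sqrt lam * ip_norm ip g"
      using M1 lam_pos g by (intro mult_nonneg_nonneg add_nonneg_nonneg) auto
    have "1 + sqrt ((M - 1) / real n) = (sqrt (real n) + sqrt (M - 1)) / sqrt (real n)"
      unfolding real_sqrt_divide using n by (simp add: add_divide_distrib)
    then have "((1 + sqrt ((M - 1) / real n)) * sqrt lam * ip_norm ip g)\<^sup>2
      = (sqrt (real n) + sqrt (M - 1))\<^sup>2 * lam * Re (ip g g) / real n"
      using lam_pos by (simp add: power_mult_distrib power_divide ip_norm_square[OF g])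
    then show "(\<Sum>i=1..n. w i * (cmod (g (x i)))\<^sup>2) \<le> ((1 + sqrt ((M - 1) / real n)) * sqrt lam * ip_norm ip g)\<^sup>2"
      unfolding sum_eq using Q(2)[OF S(3,1) g] n by (simp add: divide_right_mono)
  qed
  show ?thesis using points lower upper by (intro exI[of _ x] exI[of _ w]) blast
qed

end
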